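(* Let $R$ be a commutative coherent ring. Every torsion class in $\mathrm{mod}\,R$ is Serre. More precisely, if $M$ belongs to a torsion class $\mathcal T$ in $\mathrm{mod}\,R$, then $R/\mathrm{Ann}_R M$ belongs to $\mathcal T$, and so does every finitely presented $R$-module annihilated by $\mathrm{Ann}_R M$.
   Context: All rings are commutative with identity. A ring is coherent if each of its finitely generated ideals is finitely presented as a module. $\mathrm{mod}\,R$ is the category of finitely presented $R$-modules, abelian for coherent $R$. All subcategories are nonempty, full and closed under isomorphisms. A torsion class in $\mathrm{mod}\,R$ is a subcategory closed under quotients and extensions in $\mathrm{mod}\,R$ (no torsion pair is presupposed). A Serre subcategory of $\mathrm{mod}\,R$ is one closed under subobjects, quotients and extensions in $\mathrm{mod}\,R$. $\mathrm{Ann}_R M=\{r\in R:rM=0\}$. *)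

theory Defs
  imports "Jordan_Normal_Form.Missing_VectorSpace" "HOL-Algebra.QuotRing"
begin

text \<open>
  Modules are records \<open>('a, 'b) module\<close> over a ring \<open>R\<close> (locale \<^locale>\<open>module\<close>). That record type
  extends \<open>ring\<close>, but its fields \<open>mult\<close> and \<open>one\<close> are not part of the module structure; neither the
  locale nor \<open>module_hom\<close> looks at them. The free module \<open>R^n\<close> is the library's function space
  on \<open>{..<n}\<close>.
\<close>

abbreviation free_module :: "('a, 'r) ring_scheme \<Rightarrow> nat \<Rightarrow> ('a, nat \<Rightarrow> 'a) module"
  where "free_module R n \<equiv> ring.func_space R {..<n}"

definition module_iso ::
    "('a, 'r) ring_scheme \<Rightarrow> ('a, 'b) module \<Rightarrow> ('a, 'c) module \<Rightarrow> bool"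
  where "module_iso R M N \<longleftrightarrow> module R M \<and> module R N \<and>
    (\<exists>f \<in> module_hom R M N. bij_betw f (carrier M) (carrier N))"

text \<open>\<open>S\<close> generates the kernel of a surjection \<open>f\<close> of \<open>R^n\<close> onto \<open>M\<close>.\<close>

definition finite_presentation ::
    "('a, 'r) ring_scheme \<Rightarrow> nat \<Rightarrow> (nat \<Rightarrow> 'a) set \<Rightarrow> ((nat \<Rightarrow> 'a) \<Rightarrow> 'b) \<Rightarrow> ('a, 'b) module \<Rightarrow> bool"
  where "finite_presentation R n S f M \<longleftrightarrow>
    module R M \<and>
    f \<in> module_hom R (free_module R n) M \<and>
    f ` carrier (free_module R n) = carrier M \<and>
    finite S \<and> S \<subseteq> carrier (free_module R n) \<and>
    mod_hom.ker (free_module R n) M f = module.span R (free_module R n) S"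

definition finitely_presented :: "('a, 'r) ring_scheme \<Rightarrow> ('a, 'b) module \<Rightarrow> bool"
  where "finitely_presented R M \<longleftrightarrow> (\<exists>n S f. finite_presentation R n S f M)"

definition regular_module :: "('a, 'r) ring_scheme \<Rightarrow> ('a, 'a) module"
  where "regular_module R =
    \<lparr>carrier = carrier R, mult = mult R, one = one R, zero = zero R, add = add R, smult = mult R\<rparr>"

definition coherent_ring :: "('a, 'r) ring_scheme \<Rightarrow> bool"
  where "coherent_ring R \<longleftrightarrow> cring R \<and>
    (\<forall>S. finite S \<and> S \<subseteq> carrier R \<longrightarrow>
      finitely_presented R (regular_module R \<lparr>carrier := genideal R S\<rparr>))"

definition annihilator :: "('a, 'r) ring_scheme \<Rightarrow> ('a, 'b) module \<Rightarrow> 'a set"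
  where "annihilator R M = {r \<in> carrier R. \<forall>x \<in> carrier M. r \<odot>\<^bsub>M\<^esub> x = \<zero>\<^bsub>M\<^esub>}"

text \<open>\<open>R/I\<close> as an \<open>R\<close>-module.\<close>

definition quotient_module :: "('a, 'r) ring_scheme \<Rightarrow> 'a set \<Rightarrow> ('a, 'a set) module"
  where "quotient_module R I =
    \<lparr>carrier = carrier (R Quot I), mult = mult (R Quot I), one = one (R Quot I),
     zero = zero (R Quot I), add = add (R Quot I),
     smult = (\<lambda>r X. (I +>\<^bsub>R\<^esub> r) \<otimes>\<^bsub>R Quot I\<^esub> X)\<rparr>"


section \<open>The category of finitely presented modules and its subcategories\<close>

text \<open>
  A full subcategory closed under isomorphisms is a set of objects. All objects of one such set have
  their elements in one type \<open>'m\<close>, so \<open>fp_modules R\<close> stands for the whole of \<open>mod R\<close> provided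
  \<open>'m\<close> has room for a copy of every finitely presented \<open>R\<close>-module. This is what
  \<open>carries_all_fp\<close> says; it is a condition on the size of \<open>'m\<close> only, it holds for
  \<open>(nat \<Rightarrow> 'a) set\<close>, and it makes the finitely presented modules on all types
  available up to isomorphism (see the lemmas at the end).
\<close>

definition fp_modules :: "('a, 'r) ring_scheme \<Rightarrow> ('a, 'm) module set"
  where "fp_modules R = {M. finitely_presented R M}"

definition carries_all_fp :: "('a, 'r) ring_scheme \<Rightarrow> 'm itself \<Rightarrow> bool"
  where "carries_all_fp R (U :: 'm itself) \<longleftrightarrow>
    (\<forall>n S. finite S \<and> S \<subseteq> carrier (free_module R n) \<longrightarrow>
      (\<exists>f. \<exists>M :: ('a, 'm) module. finite_presentation R n S f M))"

definition subcategory :: "('a, 'r) ring_scheme \<Rightarrow> ('a, 'm) module set \<Rightarrow> bool"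
  where "subcategory R T \<longleftrightarrow> T \<noteq> {} \<and> T \<subseteq> fp_modules R \<and>
    (\<forall>M \<in> T. \<forall>N \<in> fp_modules R. module_iso R M N \<longrightarrow> N \<in> T)"

text \<open>
  In \<open>mod R\<close> over a coherent ring, kernels and cokernels are those of \<open>R\<close>-modules; so subobjects,
  quotients and short exact sequences are given by injective and surjective homomorphisms
  between finitely presented modules.
\<close>

definition closed_under_subobjects :: "('a, 'r) ring_scheme \<Rightarrow> ('a, 'm) module set \<Rightarrow> bool"
  where "closed_under_subobjects R T \<longleftrightarrow>
    (\<forall>M \<in> T. \<forall>L \<in> fp_modules R. \<forall>f \<in> module_hom R L M. inj_on f (carrier L) \<longrightarrow> L \<in> T)"

definition closed_under_quotients :: "('a, 'r) ring_scheme \<Rightarrow> ('a, 'm) module set \<Rightarrow> bool"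
  where "closed_under_quotients R T \<longleftrightarrow>
    (\<forall>M \<in> T. \<forall>N \<in> fp_modules R. \<forall>g \<in> module_hom R M N.
      g ` carrier M = carrier N \<longrightarrow> N \<in> T)"

definition short_exact ::
    "('a, 'r) ring_scheme \<Rightarrow> ('a, 'b) module \<Rightarrow> ('b \<Rightarrow> 'c) \<Rightarrow> ('a, 'c) module \<Rightarrow> ('c \<Rightarrow> 'd)
      \<Rightarrow> ('a, 'd) module \<Rightarrow> bool"
  where "short_exact R L f M g N \<longleftrightarrow>
    f \<in> module_hom R L M \<and> g \<in> module_hom R M N \<and>
    inj_on f (carrier L) \<and> f ` carrier L = mod_hom.ker M N g \<and> g ` carrier M = carrier N"

definition closed_under_extensions :: "('a, 'r) ring_scheme \<Rightarrow> ('a, 'm) module set \<Rightarrow> bool"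
  where "closed_under_extensions R T \<longleftrightarrow>
    (\<forall>L \<in> T. \<forall>N \<in> T. \<forall>M \<in> fp_modules R. (\<exists>f g. short_exact R L f M g N) \<longrightarrow> M \<in> T)"

definition torsion_class :: "('a, 'r) ring_scheme \<Rightarrow> ('a, 'm) module set \<Rightarrow> bool"
  where "torsion_class R T \<longleftrightarrow>
    subcategory R T \<and> closed_under_quotients R T \<and> closed_under_extensions R T"

definition serre_subcategory :: "('a, 'r) ring_scheme \<Rightarrow> ('a, 'm) module set \<Rightarrow> bool"
  where "serre_subcategory R T \<longleftrightarrow> subcategory R T \<and>
    closed_under_subobjects R T \<and> closed_under_quotients R T \<and> closed_under_extensions R T"

text \<open>Membership in \<open>T\<close> of a module whose elements may lie in another type than \<open>'m\<close>.\<close>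

definition belongs_to :: "('a, 'r) ring_scheme \<Rightarrow> ('a, 'b) module \<Rightarrow> ('a, 'm) module set \<Rightarrow> bool"
  where "belongs_to R X T \<longleftrightarrow> (\<exists>M \<in> T. module_iso R M X)"

section \<open>Adequacy of \<open>carries_all_fp\<close>\<close>

lemma (in abelian_group) minus_zero_iff:
  assumes "x \<in> carrier G" "y \<in> carrier G"
  shows "x \<ominus> y = \<zero> \<longleftrightarrow> x = y"
  using assms by (metis a_minus_def add.inv_closed minus_equality minus_minus r_neg)

lemma hom_eq_iff:
  assumes "module R F" "module R M" "f \<in> module_hom R F M" "x \<in> carrier F" "y \<in> carrier F"
  shows "f x = f y \<longleftrightarrow> x \<ominus>\<^bsub>F\<^esub> y \<in> mod_hom.ker F M f"
proof -
  interpret mod_hom R F M f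
    using assms(1-3) by (simp add: mod_hom_def mod_hom_axioms_def)
  have "f (x \<ominus>\<^bsub>F\<^esub> y) = f x \<ominus>\<^bsub>M\<^esub> f y"
    using assms(4,5) by simp
  then show ?thesis
    using assms(4,5) N.M.minus_zero_iff[of "f x" "f y"] by (simp add: ker_def)
qed

lemma module_iso_if_same_kernel:
  assumes F: "module R F" and M: "module R M" and N: "module R N"
    and f: "f \<in> module_hom R F M" "f ` carrier F = carrier M"
    and g: "g \<in> module_hom R F N" "g ` carrier F = carrier N"
    and ker: "mod_hom.ker F M f = mod_hom.ker F N g"
  shows "module_iso R M N"
proof -
  interpret F: module R F by (rule F)
  define h where "h = g \<circ> inv_into (carrier F) f"
  have eq: "f x = f y \<longleftrightarrow> g x = g y" if "x \<in> carrier F" "y \<in> carrier F" for x y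
    using hom_eq_iff[OF F M f(1) that] hom_eq_iff[OF F N g(1) that] unfolding ker by blast
  have h: "h (f x) = g x" if "x \<in> carrier F" for x
    using that eq[of "inv_into (carrier F) f (f x)" x]
      inv_into_into[of "f x" f "carrier F"] f_inv_into_f[of "f x" f "carrier F"]
    by (simp add: h_def)
  have rep: "\<exists>x \<in> carrier F. m = f x" if "m \<in> carrier M" for m
    using that unfolding f(2)[symmetric] by blast
  have h_img: "h ` carrier M = carrier N"
    by (metis (no_types, lifting) f(2) g(2) h image_cong image_image)
  have h_add: "h (m1 \<oplus>\<^bsub>M\<^esub> m2) = h m1 \<oplus>\<^bsub>N\<^esub> h m2" if m: "m1 \<in> carrier M" "m2 \<in> carrier M" for m1 m2
  proof -
    obtain x y where xy: "x \<in> carrier F" "m1 = f x" "y \<in> carrier F" "m2 = f y"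
      using rep[OF m(1)] rep[OF m(2)] by blast
    have "h (f x \<oplus>\<^bsub>M\<^esub> f y) = h (f (x \<oplus>\<^bsub>F\<^esub> y))"
      by (simp only: module_hom_add[OF f(1) xy(1,3)])
    also have "\<dots> = g x \<oplus>\<^bsub>N\<^esub> g y"
      by (simp only: h F.M.add.m_closed xy(1,3) module_hom_add[OF g(1) xy(1,3)])
    finally show ?thesis
      by (simp only: xy h)
  qed
  have h_smult: "h (r \<odot>\<^bsub>M\<^esub> m) = r \<odot>\<^bsub>N\<^esub> h m" if m: "r \<in> carrier R" "m \<in> carrier M" for r m
  proof -
    obtain x where x: "x \<in> carrier F" "m = f x"
      using rep[OF m(2)] by blast
    have "h (r \<odot>\<^bsub>M\<^esub> f x) = h (f (r \<odot>\<^bsub>F\<^esub> x))"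
      by (simp only: module_hom_smult[OF f(1) m(1) x(1)])
    also have "\<dots> = r \<odot>\<^bsub>N\<^esub> g x"
      by (simp only: h F.smult_closed m(1) x(1) module_hom_smult[OF g(1) m(1) x(1)])
    finally show ?thesis
      by (simp only: x h)
  qed
  have "h \<in> module_hom R M N"
    unfolding module_hom_def using h_img h_add h_smult by (simp add: image_subset_iff_funcset[symmetric])
  moreover note h_img
  moreover have "inj_on h (carrier M)"
  proof (rule inj_onI)
    fix m1 m2 assume "m1 \<in> carrier M" "m2 \<in> carrier M" "h m1 = h m2"
    then show "m1 = m2"
      by (metis rep h eq)
  qed
  ultimately show ?thesis
    using M N unfolding module_iso_def bij_betw_def by blast
qed

lemma cokernel_exists:
  fixes F :: "('a, 'b) module"
  assumes F: "module R F" and K: "submodule R K F"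
  shows "\<exists>f. \<exists>M :: ('a, 'b set) module. module R M \<and> f \<in> module_hom R F M \<and>
    f ` carrier F = carrier M \<and> mod_hom.ker F M f = K"
proof -
  interpret F: module R F by (rule F)
  interpret K: submodule R K F by (rule K)
  have K_neg: "\<ominus>\<^bsub>F\<^esub> k \<in> K" if "k \<in> K" for k
  proof -
    have "\<ominus>\<^bsub>F\<^esub> k = (\<ominus>\<^bsub>R\<^esub> \<one>\<^bsub>R\<^esub>) \<odot>\<^bsub>F\<^esub> k"
      using that K.subset F.smult_l_minus[of "\<one>\<^bsub>R\<^esub>" k] by auto
    then show ?thesis using that by simp
  qed
  have K_carr: "k \<in> carrier F" if "k \<in> K" for k
    using that K.subset by auto
  define f where "f x = {y \<in> carrier F. y \<ominus>\<^bsub>F\<^esub> x \<in> K}" for x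
  have f_eq: "f x = f y \<longleftrightarrow> x \<ominus>\<^bsub>F\<^esub> y \<in> K" if x: "x \<in> carrier F" and y: "y \<in> carrier F" for x y
  proof
    assume "f x = f y"
    moreover have "x \<in> f x"
      using x by (simp add: f_def a_minus_def F.M.r_neg)
    ultimately show "x \<ominus>\<^bsub>F\<^esub> y \<in> K"
      by (simp add: f_def)
  next
    assume xy: "x \<ominus>\<^bsub>F\<^esub> y \<in> K"
    have 1: "z \<ominus>\<^bsub>F\<^esub> y = (z \<ominus>\<^bsub>F\<^esub> x) \<oplus>\<^bsub>F\<^esub> (x \<ominus>\<^bsub>F\<^esub> y)" if "z \<in> carrier F" for z
      using that x y by (simp add: a_minus_def F.M.a_assoc F.M.r_neg1)
    have 2: "z \<ominus>\<^bsub>F\<^esub> x = (z \<ominus>\<^bsub>F\<^esub> y) \<oplus>\<^bsub>F\<^esub> (\<ominus>\<^bsub>F\<^esub> (x \<ominus>\<^bsub>F\<^esub> y))" if "z \<in> carrier F" for z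
      using that x y F.M.a_comm[of "\<ominus>\<^bsub>F\<^esub> x" y]
      by (simp add: a_minus_def F.M.minus_add F.M.a_assoc F.M.r_neg1)
    have "z \<ominus>\<^bsub>F\<^esub> x \<in> K \<longleftrightarrow> z \<ominus>\<^bsub>F\<^esub> y \<in> K" if z: "z \<in> carrier F" for z
    proof
      assume "z \<ominus>\<^bsub>F\<^esub> x \<in> K"
      then show "z \<ominus>\<^bsub>F\<^esub> y \<in> K" by (subst 1[OF z]) (rule K.m_closed[OF _ xy])
    next
      assume "z \<ominus>\<^bsub>F\<^esub> y \<in> K"
      then show "z \<ominus>\<^bsub>F\<^esub> x \<in> K" by (subst 2[OF z]) (rule K.m_closed[OF _ K_neg[OF xy]])
    qed
    then show "f x = f y"
      by (auto simp: f_def)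
  qed
  define r where "r = inv_into (carrier F) f"
  have r: "r X \<in> carrier F" "f (r X) = X" if "X \<in> f ` carrier F" for X
    using that by (simp_all add: r_def inv_into_into f_inv_into_f)
  define M :: "('a, 'b set) module" where
    "M = \<lparr>carrier = f ` carrier F, mult = (\<lambda>X Y. X), one = f \<zero>\<^bsub>F\<^esub>, zero = f \<zero>\<^bsub>F\<^esub>,
      add = (\<lambda>X Y. f (r X \<oplus>\<^bsub>F\<^esub> r Y)), smult = (\<lambda>a X. f (a \<odot>\<^bsub>F\<^esub> r X))\<rparr>"
  have M_simps: "carrier M = f ` carrier F" "\<zero>\<^bsub>M\<^esub> = f \<zero>\<^bsub>F\<^esub>"
    by (simp_all add: M_def)
  have rf: "r (f x) \<ominus>\<^bsub>F\<^esub> x \<in> K" "r (f x) \<in> carrier F" if "x \<in> carrier F" for x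
    using r[of "f x"] f_eq[of "r (f x)" x] that by auto
  have add: "f x \<oplus>\<^bsub>M\<^esub> f y = f (x \<oplus>\<^bsub>F\<^esub> y)" if x: "x \<in> carrier F" and y: "y \<in> carrier F" for x y
  proof -
    have "(r (f x) \<oplus>\<^bsub>F\<^esub> r (f y)) \<ominus>\<^bsub>F\<^esub> (x \<oplus>\<^bsub>F\<^esub> y) = (r (f x) \<ominus>\<^bsub>F\<^esub> x) \<oplus>\<^bsub>F\<^esub> (r (f y) \<ominus>\<^bsub>F\<^esub> y)"
      using x y rf(2)[OF x] rf(2)[OF y] by (simp add: a_minus_def F.M.minus_add F.M.a_ac)
    also have "\<dots> \<in> K"
      using rf(1)[OF x] rf(1)[OF y] by simp
    finally show ?thesis
      using f_eq x y rf(2)[OF x] rf(2)[OF y] by (simp add: M_def)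
  qed
  have smult: "a \<odot>\<^bsub>M\<^esub> f x = f (a \<odot>\<^bsub>F\<^esub> x)" if a: "a \<in> carrier R" and x: "x \<in> carrier F" for a x
  proof -
    have "a \<odot>\<^bsub>F\<^esub> r (f x) \<ominus>\<^bsub>F\<^esub> a \<odot>\<^bsub>F\<^esub> x = a \<odot>\<^bsub>F\<^esub> (r (f x) \<ominus>\<^bsub>F\<^esub> x)"
      using a x rf(2)[OF x] by (simp add: a_minus_def F.smult_r_distr F.smult_r_minus)
    also have "\<dots> \<in> K"
      using rf(1)[OF x] a by simp
    finally show ?thesis
      using f_eq a x rf(2)[OF x] by (simp add: M_def)
  qed
  have "abelian_group M"
  proof (rule abelian_groupI)
    fix X assume "X \<in> carrier M"
    then obtain x where x: "x \<in> carrier F" "X = f x" by (auto simp: M_simps)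
    then have "f (\<ominus>\<^bsub>F\<^esub> x) \<in> carrier M" "f (\<ominus>\<^bsub>F\<^esub> x) \<oplus>\<^bsub>M\<^esub> X = \<zero>\<^bsub>M\<^esub>"
      by (simp_all add: M_simps add F.M.l_neg)
    then show "\<exists>Y \<in> carrier M. Y \<oplus>\<^bsub>M\<^esub> X = \<zero>\<^bsub>M\<^esub>" ..
  qed (auto simp: M_simps add F.M.a_ac)
  then have "module R M"
    by (intro moduleI)
      (auto simp: M_simps add smult F.smult_l_distr F.smult_r_distr F.smult_assoc1
        intro: F.R.is_cring)
  moreover have "f \<in> module_hom R F M"
    by (auto simp: module_hom_def M_simps add smult)
  moreover have "mod_hom.ker F M f = K"
  proof -
    have "f x = f \<zero>\<^bsub>F\<^esub> \<longleftrightarrow> x \<in> K" if "x \<in> carrier F" for x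
      using f_eq[OF that F.M.zero_closed] that F.M.minus_equality[of "\<zero>\<^bsub>F\<^esub>" "\<zero>\<^bsub>F\<^esub>"]
      by (simp add: a_minus_def)
    then show ?thesis
      using K_carr mod_hom.ker_def[of R F M f] \<open>module R M\<close> \<open>f \<in> module_hom R F M\<close> F
      by (auto simp: mod_hom_def mod_hom_axioms_def M_simps)
  qed
  ultimately show ?thesis
    using M_simps(1) by metis
qed

lemma carries_all_fp_sets:
  assumes "cring (R :: ('a, 'r) ring_scheme)"
  shows "carries_all_fp R TYPE((nat \<Rightarrow> 'a) set)"
  unfolding carries_all_fp_def
proof (intro allI impI)
  fix n S
  assume S: "finite S \<and> S \<subseteq> carrier (free_module R n)"
  have F: "module R (free_module R n)"
    by (rule cring.func_space_is_module[OF assms])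
  show "\<exists>f. \<exists>M :: ('a, (nat \<Rightarrow> 'a) set) module. finite_presentation R n S f M"
    using cokernel_exists[OF F module.span_is_submodule[OF F]] S
    unfolding finite_presentation_def by meson
qed

lemma carries_all_fp_iso:
  fixes X :: "('a, 'b) module"
  assumes "carries_all_fp R TYPE('m)" and X: "finitely_presented R X"
  shows "\<exists>M \<in> (fp_modules R :: ('a, 'm) module set). module_iso R M X"
proof -
  obtain n S g where g: "finite_presentation R n S g X"
    using X by (auto simp: finitely_presented_def)
  then have "finite S \<and> S \<subseteq> carrier (free_module R n)"
    by (simp add: finite_presentation_def)
  then obtain f and M :: "('a, 'm) module" where f: "finite_presentation R n S f M"
    using assms(1) unfolding carries_all_fp_def by blast
  have "module R (free_module R n)"
    using g by (intro cring.func_space_is_module) (simp add: finite_presentation_def module_def)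
  then have "module_iso R M X"
    by (rule module_iso_if_same_kernel) (use f g in \<open>auto simp: finite_presentation_def\<close>)
  then show ?thesis
    using f by (auto simp: fp_modules_def finitely_presented_def)
qed

end

theory Submission
  imports Defs
begin

text \<open>
  Let \<open>T\<close> be a torsion class and \<open>M \<in> T\<close>. Everything follows once \<open>R/I\<close> is in \<open>T\<close> for the annihilator
  \<open>I\<close> of \<open>M\<close>. A finitely presented module \<open>N\<close> killed by \<open>I\<close> has a finite filtration whose factors are
  cyclic and killed by \<open>I\<close>; these are quotients of \<open>R/I\<close>, so \<open>N\<close> is in \<open>T\<close>. A submodule of \<open>M\<close> is killed
  by \<open>I\<close>, so \<open>T\<close> is closed under subobjects.

  That \<open>R/I\<close> is in \<open>T\<close> is proved by induction on the number of generators of \<open>M\<close>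
  (\<open>quotient_by_colon\<close>). Let \<open>x\<close> be one of the generators. The module \<open>M/Rx\<close> is in \<open>T\<close> and needs fewer
  generators, so \<open>R/J\<close> is in \<open>T\<close> for its annihilator \<open>J\<close>. Now \<open>JM\<close> is contained in \<open>Rx\<close>, and it
  is in \<open>T\<close>: it is a finite sum of images \<open>jM\<close> of \<open>M\<close> (\<open>subquotient_in_ideal_times\<close>). The quotient
  \<open>Rx/JM\<close> is cyclic and killed by \<open>J\<close>, because \<open>Jx\<close> lies in \<open>JM\<close>; hence it is a quotient of \<open>R/J\<close>.
  As an extension of two members, \<open>Rx\<close> is in \<open>T\<close>. So \<open>T\<close> contains \<open>R/P\<close> for the annihilator \<open>P\<close>
  of every generator, and \<open>I\<close> is the intersection of these ideals. Finally, if \<open>R/I'\<close> and \<open>R/P\<close> are in \<open>T\<close>,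
  so is \<open>R/(I' \<inter> P)\<close>: it is an extension of \<open>R/I'\<close> by \<open>(I' + P)/P\<close>, which is in \<open>T\<close> by the
  argument used for \<open>JM\<close> (\<open>cyclic_quotient_inter\<close>).

  Coherence of \<open>R\<close> guarantees that all modules above are finitely presented: finitely generated
  submodules of finitely presented modules are finitely presented, and annihilators and
  intersections are finitely generated. This rests on \<open>coherent_if_finitely_presented\<close>, the statement
  that homomorphisms from free modules into finitely presented modules have finitely generated kernels.
\<close>

section \<open>Homomorphisms and submodules\<close>

lemma module_homI:
  assumes "\<And>x. x \<in> carrier X \<Longrightarrow> f x \<in> carrier Y"
    and "\<And>x y. x \<in> carrier X \<Longrightarrow> y \<in> carrier X \<Longrightarrow> f (x \<oplus>\<^bsub>X\<^esub> y) = f x \<oplus>\<^bsub>Y\<^esub> f y"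
    and "\<And>r x. r \<in> carrier R \<Longrightarrow> x \<in> carrier X \<Longrightarrow> f (r \<odot>\<^bsub>X\<^esub> x) = r \<odot>\<^bsub>Y\<^esub> f x"
  shows "f \<in> module_hom R X Y"
  using assms by (auto simp: module_hom_def)

lemma mod_homI:
  assumes "module R X" "module R Y" "f \<in> module_hom R X Y"
  shows "mod_hom R X Y f"
  using assms by (simp add: mod_hom_def mod_hom_axioms_def)

lemma ker_eq:
  assumes "module R X" "module R Y" "f \<in> module_hom R X Y"
  shows "mod_hom.ker X Y f = {x \<in> carrier X. f x = \<zero>\<^bsub>Y\<^esub>}"
  using mod_hom.ker_def[OF mod_homI[OF assms]] .

lemma module_hom_mem: "f \<in> module_hom R X Y \<Longrightarrow> x \<in> carrier X \<Longrightarrow> f x \<in> carrier Y"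
  by (auto simp: module_hom_def)

lemma module_hom_comp:
  assumes "f \<in> module_hom R X Y" "g \<in> module_hom R Y Z"
  shows "(\<lambda>x. g (f x)) \<in> module_hom R X Z"
  using assms by (auto simp: module_hom_def Pi_def)

lemma module_hom_id: "(\<lambda>x. x) \<in> module_hom R X X"
  by (auto simp: module_hom_def)

lemma module_hom_add_fun:
  assumes Y: "module R Y" and f: "f \<in> module_hom R X Y" and g: "g \<in> module_hom R X Y"
  shows "(\<lambda>x. f x \<oplus>\<^bsub>Y\<^esub> g x) \<in> module_hom R X Y"
proof -
  interpret Y: module R Y by (rule Y)
  show ?thesis
    using module_hom_mem[OF f] module_hom_mem[OF g]
    by (intro module_homI)
      (simp_all add: module_hom_add[OF f] module_hom_add[OF g] module_hom_smult[OF f]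
        module_hom_smult[OF g] Y.smult_r_distr Y.M.a_ac)
qed

lemma module_hom_smult_right:
  assumes "module R X" "x \<in> carrier X"
  shows "(\<lambda>r. r \<odot>\<^bsub>X\<^esub> x) \<in> module_hom R (regular_module R) X"
proof -
  interpret X: module R X by fact
  show ?thesis
    using assms(2) by (intro module_homI) (simp_all add: regular_module_def X.smult_l_distr X.smult_assoc1)
qed

lemma module_hom_smult_left:
  assumes "module R X" "a \<in> carrier R"
  shows "(\<lambda>x. a \<odot>\<^bsub>X\<^esub> x) \<in> module_hom R X X"
proof -
  interpret X: module R X by fact
  show ?thesis
    using assms(2)
    by (intro module_homI) (simp_all add: X.smult_r_distr X.R.m_comm flip: X.smult_assoc1)
qed

lemma regular_module_simps [simp]:
  "carrier (regular_module R) = carrier R" "add (regular_module R) = add R"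
  "zero (regular_module R) = zero R" "smult (regular_module R) = mult R"
  by (simp_all add: regular_module_def)

lemma regular_module_is_module:
  assumes "cring R"
  shows "module R (regular_module R)"
proof -
  interpret cring R by (rule assms)
  show ?thesis
    by (intro module_criteria) (auto simp: assms a_ac m_assoc l_distr r_distr intro: r_neg)
qed

lemma module_hom_restrict:
  "f \<in> module_hom R X Y \<Longrightarrow> A \<subseteq> carrier X \<Longrightarrow> f \<in> module_hom R (X\<lparr>carrier := A\<rparr>) Y"
  by (simp add: module_hom_def Pi_def subset_iff)

lemma module_hom_onto_image:
  "f \<in> module_hom R X Y \<Longrightarrow> f ` carrier X \<subseteq> A \<Longrightarrow> f \<in> module_hom R X (Y\<lparr>carrier := A\<rparr>)"
  by (auto simp: module_hom_def)

lemma image_submodule: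
  assumes "module R X" "module R Y" "f \<in> module_hom R X Y" "submodule R A X"
  shows "submodule R (f ` A) Y"
proof -
  interpret mod_hom R X Y f by (intro mod_homI assms)
  interpret A: submodule R A X by fact
  have A: "a \<in> carrier X" if "a \<in> A" for a using that A.subset by auto
  show ?thesis
  proof
    show "\<zero>\<^bsub>Y\<^esub> \<in> f ` A"
      using f0_is_0 by (metis A.zero_closed imageI)
    fix v w assume "v \<in> f ` A" "w \<in> f ` A"
    then show "v \<oplus>\<^bsub>Y\<^esub> w \<in> f ` A"
      by clarify (metis A A.m_closed f_add imageI)
  next
    fix c v assume "c \<in> carrier R" "v \<in> f ` A"
    then show "c \<odot>\<^bsub>Y\<^esub> v \<in> f ` A"
      by clarify (metis A A.smult_closed f_smult imageI)
  qed (use A in auto)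
qed

lemma preimage_submodule:
  assumes "module R X" "module R Y" "f \<in> module_hom R X Y" "submodule R K Y"
  shows "submodule R {x \<in> carrier X. f x \<in> K} X"
proof -
  interpret mod_hom R X Y f by (intro mod_homI assms)
  interpret K: submodule R K Y by fact
  show ?thesis by standard auto
qed

lemma zero_submodule: "module R X \<Longrightarrow> submodule R {\<zero>\<^bsub>X\<^esub>} X"
  by (auto simp: submodule_def module_def abelian_group_def abelian_monoid.zero_closed
      abelian_monoid.l_zero intro: module.smult_r_null)

lemma carrier_submodule: "module R X \<Longrightarrow> submodule R (carrier X) X"
  by (auto simp: submodule_def module_def abelian_group_def abelian_monoid.zero_closed
      abelian_monoid.a_closed intro: module.smult_closed)

lemma module_hom_factor:
  assumes "module R P" "module R A" "module R Q"
    and f: "f \<in> module_hom R P A" "f ` carrier P = carrier A"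
    and g: "g \<in> module_hom R P Q"
    and ker: "\<And>p. p \<in> carrier P \<Longrightarrow> f p = \<zero>\<^bsub>A\<^esub> \<Longrightarrow> g p = \<zero>\<^bsub>Q\<^esub>"
  shows "\<exists>\<phi> \<in> module_hom R A Q. \<forall>p \<in> carrier P. \<phi> (f p) = g p"
proof -
  interpret f: mod_hom R P A f by (intro mod_homI assms)
  interpret g: mod_hom R P Q g by (intro mod_homI assms)
  define s where "s = inv_into (carrier P) f"
  have s: "s a \<in> carrier P" "f (s a) = a" if "a \<in> carrier A" for a
    using that unfolding f(2)[symmetric] s_def by (auto intro: inv_into_into f_inv_into_f)
  have eq: "g p = g q" if "p \<in> carrier P" "q \<in> carrier P" "f p = f q" for p q
  proof -
    have "f (p \<ominus>\<^bsub>P\<^esub> q) = \<zero>\<^bsub>A\<^esub>" using that by simp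
    then have "g (p \<ominus>\<^bsub>P\<^esub> q) = \<zero>\<^bsub>Q\<^esub>" using that by (intro ker) auto
    then show ?thesis using that by simp
  qed
  have "(\<lambda>a. g (s a)) \<in> module_hom R A Q"
  proof (intro module_homI)
    fix a b assume ab: "a \<in> carrier A" "b \<in> carrier A"
    have "g (s (a \<oplus>\<^bsub>A\<^esub> b)) = g (s a \<oplus>\<^bsub>P\<^esub> s b)"
      using ab s by (intro eq) auto
    then show "g (s (a \<oplus>\<^bsub>A\<^esub> b)) = g (s a) \<oplus>\<^bsub>Q\<^esub> g (s b)"
      using ab s by simp
  next
    fix r a assume ra: "r \<in> carrier R" "a \<in> carrier A"
    have "g (s (r \<odot>\<^bsub>A\<^esub> a)) = g (r \<odot>\<^bsub>P\<^esub> s a)"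
      using ra s by (intro eq) auto
    then show "g (s (r \<odot>\<^bsub>A\<^esub> a)) = r \<odot>\<^bsub>Q\<^esub> g (s a)"
      using ra s by simp
  qed (use s in auto)
  moreover have "\<forall>p \<in> carrier P. g (s (f p)) = g p"
    using s by (auto intro!: eq)
  ultimately show ?thesis by (intro bexI[of _ "\<lambda>a. g (s a)"])
qed

section \<open>Finitely generated submodules\<close>

definition adjoin :: "('a, 'r) ring_scheme \<Rightarrow> ('a, 'b) module \<Rightarrow> 'b set \<Rightarrow> 'b \<Rightarrow> 'b set"
  where "adjoin R X B x = {b \<oplus>\<^bsub>X\<^esub> r \<odot>\<^bsub>X\<^esub> x | b r. b \<in> B \<and> r \<in> carrier R}"

text \<open>
  Generators are adjoined one at a time, which makes every argument about finitely generated
  submodules an induction whose step adds a single cyclic piece. The link to spans of finite sets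
  is \<open>fg_submodule_iff_span\<close>, the link to images of free modules \<open>fg_submodule_iff_image\<close>.
\<close>

inductive fg_submodule :: "('a, 'r) ring_scheme \<Rightarrow> ('a, 'b) module \<Rightarrow> 'b set \<Rightarrow> bool"
  for R X where
  zero: "fg_submodule R X {\<zero>\<^bsub>X\<^esub>}"
| adjoin: "fg_submodule R X B \<Longrightarrow> x \<in> carrier X \<Longrightarrow> fg_submodule R X (adjoin R X B x)"

lemma adjoin_submodule:
  assumes B: "submodule R B X" and x: "x \<in> carrier X"
  shows "submodule R (adjoin R X B x) X"
proof -
  interpret B: submodule R B X by (rule B)
  interpret module R X by (rule B.module)
  have B': "b \<in> carrier X" if "b \<in> B" for b using that B.subset by auto
  show ?thesis
  proof
    show "adjoin R X B x \<subseteq> carrier X"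
      using B' x by (auto simp: adjoin_def)
    have "\<zero>\<^bsub>X\<^esub> = \<zero>\<^bsub>X\<^esub> \<oplus>\<^bsub>X\<^esub> \<zero>\<^bsub>R\<^esub> \<odot>\<^bsub>X\<^esub> x"
      using x by simp
    then show "\<zero>\<^bsub>X\<^esub> \<in> adjoin R X B x"
      unfolding adjoin_def using B.zero_closed R.zero_closed by blast
  next
    fix v w assume "v \<in> adjoin R X B x" "w \<in> adjoin R X B x"
    then obtain b r c s where b: "b \<in> B" "r \<in> carrier R" "v = b \<oplus>\<^bsub>X\<^esub> r \<odot>\<^bsub>X\<^esub> x"
      and c: "c \<in> B" "s \<in> carrier R" "w = c \<oplus>\<^bsub>X\<^esub> s \<odot>\<^bsub>X\<^esub> x"
      by (auto simp: adjoin_def)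
    have "v \<oplus>\<^bsub>X\<^esub> w = (b \<oplus>\<^bsub>X\<^esub> c) \<oplus>\<^bsub>X\<^esub> (r \<oplus>\<^bsub>R\<^esub> s) \<odot>\<^bsub>X\<^esub> x"
      using b c B' x by (simp add: smult_l_distr M.a_ac)
    then show "v \<oplus>\<^bsub>X\<^esub> w \<in> adjoin R X B x"
      unfolding adjoin_def using b c B.m_closed R.a_closed by blast
  next
    fix a v assume a: "a \<in> carrier R" and "v \<in> adjoin R X B x"
    then obtain b r where b: "b \<in> B" "r \<in> carrier R" "v = b \<oplus>\<^bsub>X\<^esub> r \<odot>\<^bsub>X\<^esub> x"
      by (auto simp: adjoin_def)
    have "a \<odot>\<^bsub>X\<^esub> v = (a \<odot>\<^bsub>X\<^esub> b) \<oplus>\<^bsub>X\<^esub> (a \<otimes>\<^bsub>R\<^esub> r) \<odot>\<^bsub>X\<^esub> x"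
      using a b B' x by (simp add: smult_r_distr smult_assoc1)
    then show "a \<odot>\<^bsub>X\<^esub> v \<in> adjoin R X B x"
      unfolding adjoin_def using a b B.smult_closed R.m_closed by blast
  qed
qed

lemma adjoin_subset:
  assumes "submodule R C X" "B \<subseteq> C" "x \<in> C"
  shows "adjoin R X B x \<subseteq> C"
proof -
  interpret C: submodule R C X by fact
  show ?thesis using assms(2,3) by (auto simp: adjoin_def)
qed

lemma subset_adjoin:
  assumes "submodule R B X" "x \<in> carrier X"
  shows "B \<subseteq> adjoin R X B x" and "x \<in> adjoin R X B x"
proof -
  interpret B: submodule R B X by fact
  interpret module R X by (rule B.module)
  show "B \<subseteq> adjoin R X B x"
  proof
    fix b assume b: "b \<in> B"
    have "b = b \<oplus>\<^bsub>X\<^esub> \<zero>\<^bsub>R\<^esub> \<odot>\<^bsub>X\<^esub> x" using b B.subset assms(2) by auto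
    then show "b \<in> adjoin R X B x" unfolding adjoin_def using b R.zero_closed by blast
  qed
  have "x = \<zero>\<^bsub>X\<^esub> \<oplus>\<^bsub>X\<^esub> \<one>\<^bsub>R\<^esub> \<odot>\<^bsub>X\<^esub> x" using assms(2) by auto
  then show "x \<in> adjoin R X B x" unfolding adjoin_def using B.zero_closed R.one_closed by blast
qed

lemma fg_submodule_is_submodule:
  assumes X: "module R X" and "fg_submodule R X A"
  shows "submodule R A X"
  using assms(2) by induction (auto intro: zero_submodule[OF X] adjoin_submodule)

lemma fg_submodule_subset: "module R X \<Longrightarrow> fg_submodule R X A \<Longrightarrow> A \<subseteq> carrier X"
  by (rule submodule.subset) (rule fg_submodule_is_submodule)

lemma image_adjoin:
  assumes "module R X" "module R Y" "f \<in> module_hom R X Y" "B \<subseteq> carrier X" "x \<in> carrier X"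
  shows "f ` adjoin R X B x = adjoin R Y (f ` B) (f x)"
proof -
  interpret mod_hom R X Y f by (intro mod_homI assms)
  have eq: "f (b \<oplus>\<^bsub>X\<^esub> r \<odot>\<^bsub>X\<^esub> x) = f b \<oplus>\<^bsub>Y\<^esub> r \<odot>\<^bsub>Y\<^esub> f x" if "b \<in> B" "r \<in> carrier R" for b r
    using that assms by auto
  show ?thesis
  proof
    show "f ` adjoin R X B x \<subseteq> adjoin R Y (f ` B) (f x)"
      unfolding adjoin_def using eq by blast
    show "adjoin R Y (f ` B) (f x) \<subseteq> f ` adjoin R X B x"
    proof
      fix y assume "y \<in> adjoin R Y (f ` B) (f x)"
      then obtain b r where br: "b \<in> B" "r \<in> carrier R" "y = f (b \<oplus>\<^bsub>X\<^esub> r \<odot>\<^bsub>X\<^esub> x)"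
        unfolding adjoin_def using eq by auto
      then show "y \<in> f ` adjoin R X B x"
        unfolding adjoin_def by blast
    qed
  qed
qed

lemma fg_submodule_image:
  assumes X: "module R X" and Y: "module R Y" and f: "f \<in> module_hom R X Y"
    and A: "fg_submodule R X A"
  shows "fg_submodule R Y (f ` A)"
  using A
proof induction
  case zero
  interpret mod_hom R X Y f by (intro mod_homI assms)
  show ?case by (simp add: fg_submodule.zero)
next
  case (adjoin B x)
  then show ?case
    using image_adjoin[OF X Y f fg_submodule_subset[OF X adjoin.hyps(1)]] module_hom_mem[OF f]
    by (simp add: fg_submodule.adjoin)
qed

lemma fg_submodule_sum:
  assumes X: "module R X" and A: "fg_submodule R X A" and "fg_submodule R X B"
  shows "fg_submodule R X (A <+>\<^bsub>X\<^esub> B)"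
  using assms(3)
proof induction
  interpret module R X by (rule X)
  note A' = fg_submodule_subset[OF X A]
  {
    case zero
    have "A <+>\<^bsub>X\<^esub> {\<zero>\<^bsub>X\<^esub>} = A"
      using A' by (force simp: set_add_def')
    then show ?case using A by simp
  next
    case (adjoin B x)
    have B': "B \<subseteq> carrier X" by (rule fg_submodule_subset[OF X adjoin.hyps(1)])
    have eq: "a \<oplus>\<^bsub>X\<^esub> (b \<oplus>\<^bsub>X\<^esub> r \<odot>\<^bsub>X\<^esub> x) = (a \<oplus>\<^bsub>X\<^esub> b) \<oplus>\<^bsub>X\<^esub> r \<odot>\<^bsub>X\<^esub> x"
      if "a \<in> A" "b \<in> B" "r \<in> carrier R" for a b r
      using that A' B' adjoin.hyps(2) by (intro M.a_assoc[symmetric]) auto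
    have "A <+>\<^bsub>X\<^esub> adjoin R X B x = adjoin R X (A <+>\<^bsub>X\<^esub> B) x"
    proof
      show "A <+>\<^bsub>X\<^esub> adjoin R X B x \<subseteq> adjoin R X (A <+>\<^bsub>X\<^esub> B) x"
        unfolding set_add_def' adjoin_def using eq by fastforce
      show "adjoin R X (A <+>\<^bsub>X\<^esub> B) x \<subseteq> A <+>\<^bsub>X\<^esub> adjoin R X B x"
        unfolding set_add_def' adjoin_def using eq[symmetric] by fastforce
    qed
    then show ?case
      using adjoin by (simp add: fg_submodule.adjoin)
  }
qed

text \<open>
  Both sides are the least submodule containing \<open>S\<close> and \<open>x\<close>.
\<close>

lemma span_insert:
  assumes X: "module R X" and "S \<subseteq> carrier X" "x \<in> carrier X"
  shows "module.span R X (insert x S) = adjoin R X (module.span R X S) x"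
proof -
  interpret module R X by (rule X)
  have S: "submodule R (span S) X" by (rule span_is_submodule) (rule assms)
  show ?thesis
  proof
    show "span (insert x S) \<subseteq> adjoin R X (span S) x"
      using in_own_span[OF assms(2)] subset_adjoin[OF S assms(3)]
      by (intro span_is_subset adjoin_submodule S assms) auto
    show "adjoin R X (span S) x \<subseteq> span (insert x S)"
      using in_own_span[of "insert x S"] assms
      by (intro adjoin_subset[OF span_is_submodule] span_is_monotone) auto
  qed
qed

lemma span_empty: "module R X \<Longrightarrow> module.span R X {} = {\<zero>\<^bsub>X\<^esub>}"
  by (auto simp: module.span_def module.lincomb_def module_def abelian_group_def
      abelian_monoid.finsum_empty)

lemma fg_submodule_span:
  assumes X: "module R X" and "finite S" "S \<subseteq> carrier X"
  shows "fg_submodule R X (module.span R X S)"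
  using assms(2,3)
  by induction (auto simp: span_empty[OF X] span_insert[OF X] intro: fg_submodule.intros)

lemma fg_submodule_iff_span:
  assumes X: "module R X"
  shows "fg_submodule R X A \<longleftrightarrow> (\<exists>S. finite S \<and> S \<subseteq> carrier X \<and> A = module.span R X S)"
proof
  assume "fg_submodule R X A"
  then show "\<exists>S. finite S \<and> S \<subseteq> carrier X \<and> A = module.span R X S"
  proof induction
    case zero
    then show ?case using span_empty[OF X] by blast
  next
    case (adjoin B x)
    then obtain S where "finite S" "S \<subseteq> carrier X" "B = module.span R X S" by blast
    then show ?case
      using span_insert[OF X] adjoin.hyps(2) by (intro exI[of _ "insert x S"]) auto
  qed
qed (auto intro: fg_submodule_span[OF X])

section \<open>Homomorphisms from free modules\<close>

lemma free_module_simps: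
  assumes "cring R"
  shows "carrier (free_module R n) = {..<n} \<rightarrow>\<^sub>E carrier R"
    and "\<zero>\<^bsub>free_module R n\<^esub> = (\<lambda>i\<in>{..<n}. \<zero>\<^bsub>R\<^esub>)"
    and "v \<oplus>\<^bsub>free_module R n\<^esub> w = (\<lambda>i\<in>{..<n}. v i \<oplus>\<^bsub>R\<^esub> w i)"
    and "r \<odot>\<^bsub>free_module R n\<^esub> v = (\<lambda>i\<in>{..<n}. r \<otimes>\<^bsub>R\<^esub> v i)"
  by (simp_all add: ring.func_space_def[OF cring.axioms(1)[OF assms]])

lemma free_module_is_module: "cring R \<Longrightarrow> module R (free_module R n)"
  by (rule cring.func_space_is_module)

lemma module_hom_truncate:
  assumes "cring R"
  shows "(\<lambda>v. restrict v {..<n}) \<in> module_hom R (free_module R (Suc n)) (free_module R n)"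
  by (intro module_homI) (auto simp: free_module_simps[OF assms] fun_eq_iff PiE_iff)

lemma module_hom_coordinate:
  assumes "cring R" "k < n"
  shows "(\<lambda>v. v k) \<in> module_hom R (free_module R n) (regular_module R)"
  using assms(2) by (intro module_homI) (auto simp: free_module_simps[OF assms(1)] PiE_iff)

lemma free_module_truncate:
  assumes "cring R" "v \<in> carrier (free_module R (Suc n))"
  shows "restrict v {..<n} \<in> carrier (free_module R n)" and "v n \<in> carrier R"
  using assms(2) by (simp_all add: free_module_simps[OF assms(1)] PiE_iff)

lemma free_module_snoc:
  assumes "cring R" "w \<in> carrier (free_module R n)" "r \<in> carrier R"
  shows "w(n := r) \<in> carrier (free_module R (Suc n))" and "restrict (w(n := r)) {..<n} = w"
  using assms(2,3) by (auto simp: free_module_simps[OF assms(1)] fun_eq_iff PiE_iff extensional_def)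

text \<open>
  Together with \<open>module_hom_split\<close> this is the decomposition \<open>R^(n+1) = R^n \<oplus> R\<close>: a homomorphism
  from \<open>R^(n+1)\<close> is a homomorphism from \<open>R^n\<close> and an image for the last basis vector. Restriction to
  \<open>{..<n}\<close> is the projection onto the first summand.
\<close>

lemma module_hom_extend:
  assumes R: "cring R" and X: "module R X" and f: "f \<in> module_hom R (free_module R n) X"
    and x: "x \<in> carrier X"
  shows "(\<lambda>v. f (restrict v {..<n}) \<oplus>\<^bsub>X\<^esub> v n \<odot>\<^bsub>X\<^esub> x) \<in> module_hom R (free_module R (Suc n)) X"
  using module_hom_comp[OF module_hom_truncate[OF R] f]
    module_hom_comp[OF module_hom_coordinate[OF R lessI] module_hom_smult_right[OF X x]]
  by (rule module_hom_add_fun[OF X])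

lemma module_hom_split:
  assumes R: "cring R" and X: "module R X" and f: "f \<in> module_hom R (free_module R (Suc n)) X"
  shows "\<exists>g \<in> module_hom R (free_module R n) X. \<exists>x \<in> carrier X.
    \<forall>v \<in> carrier (free_module R (Suc n)). f v = g (restrict v {..<n}) \<oplus>\<^bsub>X\<^esub> v n \<odot>\<^bsub>X\<^esub> x"
proof -
  interpret R: cring R by (rule R)
  note fs = free_module_simps[OF R]
  define e where "e = (\<lambda>i\<in>{..<Suc n}. if i = n then \<one>\<^bsub>R\<^esub> else \<zero>\<^bsub>R\<^esub>)"
  have e: "e \<in> carrier (free_module R (Suc n))"
    by (simp add: e_def fs PiE_iff)
  have "(\<lambda>w. w(n := \<zero>\<^bsub>R\<^esub>)) \<in> module_hom R (free_module R n) (free_module R (Suc n))"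
    by (intro module_homI) (auto simp: fs fun_eq_iff PiE_iff extensional_def)
  from module_hom_comp[OF this f]
  have g: "(\<lambda>w. f (w(n := \<zero>\<^bsub>R\<^esub>))) \<in> module_hom R (free_module R n) X" .
  have "f v = f ((restrict v {..<n})(n := \<zero>\<^bsub>R\<^esub>)) \<oplus>\<^bsub>X\<^esub> v n \<odot>\<^bsub>X\<^esub> f e"
    if v: "v \<in> carrier (free_module R (Suc n))" for v
  proof -
    note vn = free_module_truncate(2,1)[OF R v]
    have "v = (restrict v {..<n})(n := \<zero>\<^bsub>R\<^esub>) \<oplus>\<^bsub>free_module R (Suc n)\<^esub> v n \<odot>\<^bsub>free_module R (Suc n)\<^esub> e"
    proof
      fix i
      have in_R: "v i \<in> carrier R" if "i < Suc n" for i
        using v that by (simp add: fs PiE_iff)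
      have out: "v i = undefined" if "\<not> i < Suc n"
        using v that by (simp add: fs PiE_iff extensional_def)
      consider "i < n" | "i = n" | "\<not> i < Suc n" by linarith
      then show "v i = ((restrict v {..<n})(n := \<zero>\<^bsub>R\<^esub>) \<oplus>\<^bsub>free_module R (Suc n)\<^esub> v n \<odot>\<^bsub>free_module R (Suc n)\<^esub> e) i"
        by cases (simp_all add: fs e_def in_R out)
    qed
    then have "f v = f ((restrict v {..<n})(n := \<zero>\<^bsub>R\<^esub>) \<oplus>\<^bsub>free_module R (Suc n)\<^esub> v n \<odot>\<^bsub>free_module R (Suc n)\<^esub> e)"
      by (rule arg_cong)
    also have "\<dots> = f ((restrict v {..<n})(n := \<zero>\<^bsub>R\<^esub>)) \<oplus>\<^bsub>X\<^esub> f (v n \<odot>\<^bsub>free_module R (Suc n)\<^esub> e)"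
      using module.smult_closed[OF free_module_is_module[OF R] vn(1) e]
      by (intro module_hom_add[OF f] free_module_snoc R vn R.zero_closed)
    finally show ?thesis
      by (simp only: module_hom_smult[OF f vn(1) e])
  qed
  then show ?thesis
    by (intro bexI[OF _ g] bexI[OF _ module_hom_mem[OF f e]]) simp
qed

lemma image_extend:
  assumes R: "cring R"
  shows "(\<lambda>v. g (restrict v {..<n}) \<oplus>\<^bsub>X\<^esub> v n \<odot>\<^bsub>X\<^esub> x) ` carrier (free_module R (Suc n))
    = adjoin R X (g ` carrier (free_module R n)) x"
proof
  show "(\<lambda>v. g (restrict v {..<n}) \<oplus>\<^bsub>X\<^esub> v n \<odot>\<^bsub>X\<^esub> x) ` carrier (free_module R (Suc n))
    \<subseteq> adjoin R X (g ` carrier (free_module R n)) x"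
  proof clarify
    fix v assume v: "v \<in> carrier (free_module R (Suc n))"
    then have "restrict v {..<n} \<in> carrier (free_module R n)" "v n \<in> carrier R"
      by (simp_all add: free_module_truncate[OF R])
    then show "g (restrict v {..<n}) \<oplus>\<^bsub>X\<^esub> v n \<odot>\<^bsub>X\<^esub> x \<in> adjoin R X (g ` carrier (free_module R n)) x"
      unfolding adjoin_def by blast
  qed
  show "adjoin R X (g ` carrier (free_module R n)) x
    \<subseteq> (\<lambda>v. g (restrict v {..<n}) \<oplus>\<^bsub>X\<^esub> v n \<odot>\<^bsub>X\<^esub> x) ` carrier (free_module R (Suc n))"
  proof
    fix y assume "y \<in> adjoin R X (g ` carrier (free_module R n)) x"
    then obtain w r where w: "w \<in> carrier (free_module R n)" "r \<in> carrier R" "y = g w \<oplus>\<^bsub>X\<^esub> r \<odot>\<^bsub>X\<^esub> x"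
      by (auto simp: adjoin_def)
    then show "y \<in> (\<lambda>v. g (restrict v {..<n}) \<oplus>\<^bsub>X\<^esub> v n \<odot>\<^bsub>X\<^esub> x) ` carrier (free_module R (Suc n))"
      using free_module_snoc[OF R w(1,2)] by (intro rev_image_eqI[of "w(n := r)"]) auto
  qed
qed

lemma free_module_0_carrier:
  "cring R \<Longrightarrow> carrier (free_module R 0) = {\<zero>\<^bsub>free_module R 0\<^esub>}"
  by (simp add: ring.func_space_def[OF cring.axioms(1)] restrict_def)

lemma fg_submodule_iff_image:
  fixes X :: "('a, 'b) module"
  assumes R: "cring R" and X: "module R X"
  shows "fg_submodule R X A \<longleftrightarrow>
    (\<exists>n. \<exists>f \<in> module_hom R (free_module R n) X. f ` carrier (free_module R n) = A)"
proof
  interpret X: module R X by (rule X)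
  assume "fg_submodule R X A"
  then show "\<exists>n. \<exists>f \<in> module_hom R (free_module R n) X. f ` carrier (free_module R n) = A"
  proof induction
    case zero
    have "(\<lambda>_. \<zero>\<^bsub>X\<^esub>) \<in> module_hom R (free_module R 0) X"
      by (intro module_homI) auto
    then show ?case
      using free_module_0_carrier[OF R] by (intro exI[of _ 0]) force
  next
    case (adjoin B x)
    then obtain n f where "f \<in> module_hom R (free_module R n) X" "f ` carrier (free_module R n) = B"
      by blast
    then show ?case
      using module_hom_extend[OF R X _ adjoin.hyps(2)] image_extend[OF R, where g = f and n = n and X = X and x = x]
      by blast
  qed
next
  have "fg_submodule R X (f ` carrier (free_module R n))"
    if "f \<in> module_hom R (free_module R n) X" for f n
    using that
  proof (induction n arbitrary: f)
    case 0
    then have "f ` carrier (free_module R 0) = {\<zero>\<^bsub>X\<^esub>}"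
      using mod_hom.f0_is_0[OF mod_homI[OF free_module_is_module[OF R] X]] free_module_0_carrier[OF R]
      by fastforce
    then show ?case by (simp add: fg_submodule.zero)
  next
    case (Suc n)
    obtain g x where g: "g \<in> module_hom R (free_module R n) X" "x \<in> carrier X"
      "\<And>v. v \<in> carrier (free_module R (Suc n)) \<Longrightarrow> f v = g (restrict v {..<n}) \<oplus>\<^bsub>X\<^esub> v n \<odot>\<^bsub>X\<^esub> x"
      using module_hom_split[OF R X Suc.prems] by blast
    then have "f ` carrier (free_module R (Suc n)) = adjoin R X (g ` carrier (free_module R n)) x"
      unfolding image_extend[OF R, symmetric] by (intro image_cong) auto
    then show ?case
      using g Suc.IH by (simp add: fg_submodule.adjoin)
  qed
  then show "\<exists>n. \<exists>f \<in> module_hom R (free_module R n) X. f ` carrier (free_module R n) = A \<Longrightarrow> fg_submodule R X A"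
    by blast
qed

lemma fg_submodule_free_module:
  assumes R: "cring R"
  shows "fg_submodule R (free_module R n) (carrier (free_module R n))"
  unfolding fg_submodule_iff_image[OF R free_module_is_module[OF R]]
  by (intro exI[of _ n] bexI[of _ "\<lambda>v. v"] module_hom_id) auto

text \<open>
  Free modules are projective. The lift is built one coordinate at a time: a lift on \<open>R^n\<close> and a
  preimage of the image of the last basis vector give a lift on \<open>R^(n+1)\<close>.
\<close>

lemma free_module_lift:
  fixes P :: "('a, 'b) module" and X :: "('a, 'c) module"
  assumes R: "cring R" and P: "module R P" and X: "module R X"
    and f: "f \<in> module_hom R P X"
    and "g \<in> module_hom R (free_module R n) X" "g ` carrier (free_module R n) \<subseteq> f ` carrier P"
  shows "\<exists>h \<in> module_hom R (free_module R n) P. \<forall>v \<in> carrier (free_module R n). f (h v) = g v"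
  using assms(5,6)
proof (induction n arbitrary: g)
  interpret f: mod_hom R P X f by (intro mod_homI P X f)
  {
    case 0
    have "(\<lambda>_. \<zero>\<^bsub>P\<^esub>) \<in> module_hom R (free_module R 0) P"
      by (intro module_homI) auto
    moreover have "\<forall>v \<in> carrier (free_module R 0). f \<zero>\<^bsub>P\<^esub> = g v"
      using mod_hom.f0_is_0[OF mod_homI[OF free_module_is_module[OF R] X 0(1)]]
        free_module_0_carrier[OF R] f.f0_is_0 by fastforce
    ultimately show ?case by (intro bexI[of _ "\<lambda>_. \<zero>\<^bsub>P\<^esub>"])
  next
    case (Suc n)
    obtain k x where k: "k \<in> module_hom R (free_module R n) X" and x: "x \<in> carrier X"
      and gk: "\<And>v. v \<in> carrier (free_module R (Suc n)) \<Longrightarrow> g v = k (restrict v {..<n}) \<oplus>\<^bsub>X\<^esub> v n \<odot>\<^bsub>X\<^esub> x"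
      using module_hom_split[OF R X Suc.prems(1)] by blast
    have "g ` carrier (free_module R (Suc n)) = adjoin R X (k ` carrier (free_module R n)) x"
      unfolding image_extend[OF R, symmetric] using gk by (intro image_cong) auto
    then have adj: "adjoin R X (k ` carrier (free_module R n)) x \<subseteq> f ` carrier P"
      using Suc.prems(2) by simp
    have "submodule R (k ` carrier (free_module R n)) X"
      by (intro image_submodule[OF free_module_is_module[OF R] X k] carrier_submodule free_module_is_module R)
    note sub = order_trans[OF subset_adjoin(1)[OF this x] adj] subsetD[OF adj subset_adjoin(2)[OF this x]]
    obtain h where h: "h \<in> module_hom R (free_module R n) P"
      "\<And>v. v \<in> carrier (free_module R n) \<Longrightarrow> f (h v) = k v"
      using Suc.IH[OF k sub(1)] by blast
    obtain p where p: "p \<in> carrier P" "f p = x"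
      using sub(2) by blast
    have "f (h (restrict v {..<n}) \<oplus>\<^bsub>P\<^esub> v n \<odot>\<^bsub>P\<^esub> p) = g v" if v: "v \<in> carrier (free_module R (Suc n))" for v
    proof -
      show ?thesis
        using free_module_truncate[OF R v] gk[OF v] h p module_hom_mem[OF h(1)] by simp
    qed
    then show ?case
      by (intro bexI[OF _ module_hom_extend[OF R P h(1) p(1)]]) simp
  }
qed

section \<open>Coherent modules\<close>

text \<open>
  Equivalently, every finitely generated submodule of \<open>X\<close> is finitely presented. The formulation by
  kernels speaks of all finite families in \<open>X\<close> at once and is the one that passes from \<open>R\<close> to \<open>R^n\<close>
  and from there to finitely presented modules.
\<close>

definition coherent_module :: "('a, 'r) ring_scheme \<Rightarrow> ('a, 'b) module \<Rightarrow> bool"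
  where "coherent_module R X \<longleftrightarrow> module R X \<and>
    (\<forall>n. \<forall>f \<in> module_hom R (free_module R n) X.
      fg_submodule R (free_module R n) {v \<in> carrier (free_module R n). f v = \<zero>\<^bsub>X\<^esub>})"

lemma coherent_module_is_module: "coherent_module R X \<Longrightarrow> module R X"
  by (simp add: coherent_module_def)

text \<open>
  Induction on the generators of \<open>K\<close>. The vectors mapped into \<open>B + Rx\<close> are the truncations of the
  vectors \<open>(v, r)\<close> of \<open>R^(n+1)\<close> with \<open>f v - r x \<in> B\<close>, so the case of \<open>B + Rx\<close> follows from that of
  \<open>B\<close> for one more coordinate.
\<close>

lemma fg_preimage_free_module:
  assumes R: "cring R" and X: "coherent_module R X" and "fg_submodule R X K"
    and "f \<in> module_hom R (free_module R n) X"
  shows "fg_submodule R (free_module R n) {v \<in> carrier (free_module R n). f v \<in> K}"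
  using assms(3,4)
proof (induction arbitrary: n f)
  note X' = coherent_module_is_module[OF X]
  interpret X: module R X by (rule X')
  {
    case zero
    then show ?case using X by (simp add: coherent_module_def)
  next
    case (adjoin B x)
    let ?f' = "\<lambda>v. f (restrict v {..<n}) \<oplus>\<^bsub>X\<^esub> v n \<odot>\<^bsub>X\<^esub> (\<ominus>\<^bsub>X\<^esub> x)"
    note x = adjoin.hyps(2) and B = fg_submodule_is_submodule[OF X' adjoin.hyps(1)]
    note B' = submodule.subset[OF B]
    have "?f' \<in> module_hom R (free_module R (Suc n)) X"
      using x by (intro module_hom_extend R X' adjoin.prems) auto
    from adjoin.IH[OF this]
    have "fg_submodule R (free_module R n)
      ((\<lambda>v. restrict v {..<n}) ` {v \<in> carrier (free_module R (Suc n)). ?f' v \<in> B})"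
      by (rule fg_submodule_image[OF free_module_is_module[OF R] free_module_is_module[OF R]
            module_hom_truncate[OF R]])
    also have "(\<lambda>v. restrict v {..<n}) ` {v \<in> carrier (free_module R (Suc n)). ?f' v \<in> B}
      = {v \<in> carrier (free_module R n). f v \<in> adjoin R X B x}" (is "?L = ?R")
    proof
      show "?L \<subseteq> ?R"
      proof clarify
        fix v assume v: "v \<in> carrier (free_module R (Suc n))" "?f' v \<in> B"
        note w = free_module_truncate[OF R v(1)]
        have "f (restrict v {..<n}) = ?f' v \<oplus>\<^bsub>X\<^esub> v n \<odot>\<^bsub>X\<^esub> x"
          using module_hom_mem[OF adjoin.prems w(1)] X.smult_closed[OF w(2) x]
          by (simp only: X.smult_r_minus[OF w(2) x] X.M.a_assoc X.M.l_neg X.M.r_zero X.M.a_inv_closed)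
        then have "f (restrict v {..<n}) \<in> adjoin R X B x"
          unfolding adjoin_def using v(2) w(2) by blast
        then show "restrict v {..<n} \<in> carrier (free_module R n) \<and> f (restrict v {..<n}) \<in> adjoin R X B x"
          using w by simp
      qed
      show "?R \<subseteq> ?L"
      proof clarify
        fix w assume w: "w \<in> carrier (free_module R n)" "f w \<in> adjoin R X B x"
        then obtain b r where b: "b \<in> B" "r \<in> carrier R" "f w = b \<oplus>\<^bsub>X\<^esub> r \<odot>\<^bsub>X\<^esub> x"
          by (auto simp: adjoin_def)
        have "?f' (w(n := r)) = b"
          using b B' x free_module_snoc[OF R w(1) b(2)]
          by (simp add: X.smult_r_minus X.M.a_assoc X.M.r_neg subset_iff)
        then show "w \<in> ?L"
          using free_module_snoc[OF R w(1) b(2)] b(1)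
          by (intro rev_image_eqI[of "w(n := r)"]) auto
      qed
    qed
    finally show ?case .
  }
qed

text \<open>
  Schanuel's argument: finite generation of the kernel for one finite presentation \<open>q\<close> gives it for
  every surjection \<open>g\<close> from a free module. Lift each of the two through the other, \<open>q h = g\<close> and
  \<open>g k = q\<close>. Then the kernel of \<open>g\<close> is generated by \<open>k (ker q)\<close> and the image of \<open>1 - k h\<close>.
\<close>

lemma fg_kernel_if_finitely_presented:
  assumes R: "cring R" and "finitely_presented R X"
    and g: "g \<in> module_hom R (free_module R m) X" "g ` carrier (free_module R m) = carrier X"
  shows "fg_submodule R (free_module R m) {v \<in> carrier (free_module R m). g v = \<zero>\<^bsub>X\<^esub>}"
proof -
  obtain n S q where q: "finite_presentation R n S q X"
    using assms(2) by (auto simp: finitely_presented_def)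
  let ?G = "free_module R m" and ?F = "free_module R n"
  note G = free_module_is_module[OF R, of m] and F = free_module_is_module[OF R, of n]
  have X: "module R X" and q_hom: "q \<in> module_hom R ?F X" and q_onto: "q ` carrier ?F = carrier X"
    and S: "finite S" "S \<subseteq> carrier ?F" "mod_hom.ker ?F X q = module.span R ?F S"
    using q by (auto simp: finite_presentation_def)
  have ker_q: "fg_submodule R ?F {v \<in> carrier ?F. q v = \<zero>\<^bsub>X\<^esub>}"
    unfolding ker_eq[OF F X q_hom, symmetric] S(3) using S(1,2) by (rule fg_submodule_span[OF F])
  obtain h where h: "h \<in> module_hom R ?G ?F" "\<And>v. v \<in> carrier ?G \<Longrightarrow> q (h v) = g v"
    using free_module_lift[OF R F X q_hom g(1)] g(2) q_onto by auto
  obtain k where k: "k \<in> module_hom R ?F ?G" "\<And>v. v \<in> carrier ?F \<Longrightarrow> g (k v) = q v"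
    using free_module_lift[OF R G X g(1) q_hom] g(2) q_onto by auto
  interpret G: module R ?G by (rule G)
  interpret F: module R ?F by (rule F)
  interpret g: mod_hom R ?G X g by (intro mod_homI G X g)
  \<comment> \<open>\<open>1 - k h\<close>, with the minus sign as a scalar\<close>
  let ?d = "\<lambda>v. v \<oplus>\<^bsub>?G\<^esub> (\<ominus>\<^bsub>R\<^esub> \<one>\<^bsub>R\<^esub>) \<odot>\<^bsub>?G\<^esub> k (h v)"
  have d: "?d \<in> module_hom R ?G ?G"
    by (intro module_hom_add_fun G module_hom_id module_hom_comp[OF module_hom_comp[OF h(1) k(1)]]
        module_hom_smult_left) auto
  have kh: "k (h v) \<in> carrier ?G" "g (k (h v)) = g v" if "v \<in> carrier ?G" for v
    using that h k module_hom_mem[OF h(1)] module_hom_mem[OF k(1)] by auto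
  have "{v \<in> carrier ?G. g v = \<zero>\<^bsub>X\<^esub>} = (?d ` carrier ?G) <+>\<^bsub>?G\<^esub> (k ` {v \<in> carrier ?F. q v = \<zero>\<^bsub>X\<^esub>})"
    (is "?K = ?D <+>\<^bsub>?G\<^esub> ?E")
  proof
    show "?K \<subseteq> ?D <+>\<^bsub>?G\<^esub> ?E"
    proof clarify
      fix v assume v: "v \<in> carrier ?G" "g v = \<zero>\<^bsub>X\<^esub>"
      have "v = ?d v \<oplus>\<^bsub>?G\<^esub> k (h v)"
        using v kh by (simp add: G.smult_minus_1 G.M.a_assoc G.M.l_neg)
      moreover have "k (h v) \<in> ?E"
        using v h module_hom_mem[OF h(1)] by auto
      ultimately show "v \<in> ?D <+>\<^bsub>?G\<^esub> ?E"
        unfolding set_add_def' using v(1) by blast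
    qed
    show "?D <+>\<^bsub>?G\<^esub> ?E \<subseteq> ?K"
    proof
      fix y assume "y \<in> ?D <+>\<^bsub>?G\<^esub> ?E"
      then obtain v w where vw: "v \<in> carrier ?G" "w \<in> carrier ?F" "q w = \<zero>\<^bsub>X\<^esub>" "y = ?d v \<oplus>\<^bsub>?G\<^esub> k w"
        by (auto simp: set_add_def')
      have "g (?d v) = \<zero>\<^bsub>X\<^esub>"
        using vw(1) kh by (simp add: G.smult_minus_1 g.N.M.r_neg)
      then have "g y = \<zero>\<^bsub>X\<^esub>"
        using vw k module_hom_mem[OF k(1) vw(2)] module_hom_mem[OF d vw(1)] by simp
      then show "y \<in> ?K"
        using vw module_hom_mem[OF k(1) vw(2)] module_hom_mem[OF d vw(1)] by simp
    qed
  qed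
  then show ?thesis
    using fg_submodule_sum[OF G fg_submodule_image[OF G G d fg_submodule_free_module[OF R]]
        fg_submodule_image[OF F G k(1) ker_q]] by simp
qed

lemma submodule_regular_module_iff:
  assumes "cring R"
  shows "submodule R I (regular_module R) \<longleftrightarrow> ideal I R"
proof
  interpret R: cring R by fact
  note M = regular_module_is_module[OF assms]
  {
    assume "submodule R I (regular_module R)"
    then interpret I: submodule R I "regular_module R" .
    have I: "I \<subseteq> carrier R" "\<zero>\<^bsub>R\<^esub> \<in> I" "\<And>a b. a \<in> I \<Longrightarrow> b \<in> I \<Longrightarrow> a \<oplus>\<^bsub>R\<^esub> b \<in> I"
      "\<And>a b. a \<in> carrier R \<Longrightarrow> b \<in> I \<Longrightarrow> a \<otimes>\<^bsub>R\<^esub> b \<in> I"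
      using I.subset I.zero_closed I.m_closed I.smult_closed by auto
    have neg: "\<ominus>\<^bsub>R\<^esub> a \<in> I" if "a \<in> I" for a
    proof -
      have "\<ominus>\<^bsub>R\<^esub> a = (\<ominus>\<^bsub>R\<^esub> \<one>\<^bsub>R\<^esub>) \<otimes>\<^bsub>R\<^esub> a"
        using subsetD[OF I(1) that] by (simp add: R.l_minus)
      then show ?thesis using that by (simp add: I(4))
    qed
    show "ideal I R"
    proof (rule idealI)
      show "subgroup I (add_monoid R)"
        using I neg by (intro R.add.subgroupI) (auto simp: a_inv_def)
      show "x \<otimes>\<^bsub>R\<^esub> a \<in> I" if "a \<in> I" "x \<in> carrier R" for a x using I(4) that by simp
      then show "a \<otimes>\<^bsub>R\<^esub> x \<in> I" if "a \<in> I" "x \<in> carrier R" for a x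
        using that I(1) R.m_comm[of a x] by auto
    qed (rule cring.axioms(1)[OF R.is_cring])
  next
    assume "ideal I R"
    then interpret I: ideal I R .
    show "submodule R I (regular_module R)"
      using I.a_subset I.zero_closed I.I_l_closed I.a_closed M by (auto simp: submodule_def)
  }
qed

text \<open>
  A homomorphism \<open>R^n \<rightarrow> R\<close> is a surjection onto a finitely generated ideal, which is finitely
  presented over a coherent ring.
\<close>

lemma coherent_regular_module:
  assumes "coherent_ring R"
  shows "coherent_module R (regular_module R)"
  unfolding coherent_module_def
proof (intro conjI allI ballI)
  have R: "cring R" using assms by (simp add: coherent_ring_def)
  interpret R: cring R by (rule R)
  note M = regular_module_is_module[OF R]
  show "module R (regular_module R)" by (rule M)
  fix n f assume f: "f \<in> module_hom R (free_module R n) (regular_module R)"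
  let ?I = "f ` carrier (free_module R n)"
  have "fg_submodule R (regular_module R) ?I"
    using f fg_submodule_iff_image[OF R M] by blast
  then obtain S where S: "finite S" "S \<subseteq> carrier R" "?I = module.span R (regular_module R) S"
    using fg_submodule_iff_span[OF M] by auto
  have span: "submodule R (module.span R (regular_module R) S) (regular_module R)"
    using S by (intro module.span_is_submodule[OF M]) simp
  have "?I = genideal R S"
  proof
    show "?I \<subseteq> genideal R S"
      unfolding S(3) using R.genideal_ideal[OF S(2)] R.genideal_self[OF S(2)]
      by (intro module.span_is_subset[OF M]) (auto simp: submodule_regular_module_iff[OF R])
    show "genideal R S \<subseteq> ?I"
      unfolding S(3) using span module.in_own_span[OF M, of S] S(2)
      by (intro R.genideal_minimal) (auto simp: submodule_regular_module_iff[OF R])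
  qed
  then have "finitely_presented R (regular_module R\<lparr>carrier := ?I\<rparr>)"
    using assms S by (auto simp: coherent_ring_def)
  from fg_kernel_if_finitely_presented[OF R this module_hom_onto_image[OF f]]
  show "fg_submodule R (free_module R n) {v \<in> carrier (free_module R n). f v = \<zero>\<^bsub>regular_module R\<^esub>}"
    by simp
qed

text \<open>
  The coordinates of \<open>f\<close> are made to vanish one after the other. If \<open>g\<close> parametrises the vectors on
  which the first \<open>k\<close> coordinates vanish, then those on which coordinate \<open>k\<close> vanishes as well form the
  image under \<open>g\<close> of the kernel of a homomorphism into \<open>R\<close>.
\<close>

lemma coherent_free_module:
  assumes "coherent_ring R"
  shows "coherent_module R (free_module R n)"
  unfolding coherent_module_def
proof (intro conjI allI ballI)
  have R: "cring R" using assms by (simp add: coherent_ring_def)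
  note F = free_module_is_module[OF R]
  show "module R (free_module R n)" by (rule F)
  fix m f assume f: "f \<in> module_hom R (free_module R m) (free_module R n)"
  have "fg_submodule R (free_module R m) {v \<in> carrier (free_module R m). \<forall>i<k. f v i = \<zero>\<^bsub>R\<^esub>}"
    if "k \<le> n" for k
    using that
  proof (induction k)
    case 0
    then show ?case by (simp add: fg_submodule_free_module[OF R])
  next
    case (Suc k)
    then obtain p g where g: "g \<in> module_hom R (free_module R p) (free_module R m)"
      "g ` carrier (free_module R p) = {v \<in> carrier (free_module R m). \<forall>i<k. f v i = \<zero>\<^bsub>R\<^esub>}"
      unfolding fg_submodule_iff_image[OF R F] by auto
    have "(\<lambda>w. f (g w) k) \<in> module_hom R (free_module R p) (regular_module R)"
      using module_hom_comp[OF module_hom_comp[OF g(1) f] module_hom_coordinate[OF R]] Suc.prems by simp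
    then have "fg_submodule R (free_module R p) {w \<in> carrier (free_module R p). f (g w) k = \<zero>\<^bsub>R\<^esub>}"
      using coherent_regular_module[OF assms] by (auto simp: coherent_module_def)
    from fg_submodule_image[OF F F g(1) this]
    have "fg_submodule R (free_module R m) (g ` {w \<in> carrier (free_module R p). f (g w) k = \<zero>\<^bsub>R\<^esub>})" .
    also have "g ` {w \<in> carrier (free_module R p). f (g w) k = \<zero>\<^bsub>R\<^esub>}
      = {v \<in> g ` carrier (free_module R p). f v k = \<zero>\<^bsub>R\<^esub>}"
      by auto
    also have "\<dots> = {v \<in> carrier (free_module R m). \<forall>i<Suc k. f v i = \<zero>\<^bsub>R\<^esub>}"
      unfolding g(2) by (auto simp: less_Suc_eq)
    finally show ?case .
  qed
  from this[OF order_refl]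
  show "fg_submodule R (free_module R m) {v \<in> carrier (free_module R m). f v = \<zero>\<^bsub>free_module R n\<^esub>}"
  proof (rule back_subst[of "fg_submodule R (free_module R m)"])
    have "(\<forall>i<n. f v i = \<zero>\<^bsub>R\<^esub>) \<longleftrightarrow> f v = \<zero>\<^bsub>free_module R n\<^esub>" if "v \<in> carrier (free_module R m)" for v
      using module_hom_mem[OF f that]
      by (auto simp: free_module_simps[OF R] fun_eq_iff PiE_iff extensional_def)
    then show "{v \<in> carrier (free_module R m). \<forall>i<n. f v i = \<zero>\<^bsub>R\<^esub>}
      = {v \<in> carrier (free_module R m). f v = \<zero>\<^bsub>free_module R n\<^esub>}" by auto
  qed
qed

text \<open>
  If \<open>X\<close> is presented by \<open>q\<close> and \<open>h\<close> lifts \<open>f\<close> to \<open>R^n\<close>, the kernel of \<open>f\<close> is the preimage under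
  \<open>h\<close> of the finitely generated kernel of \<open>q\<close>.
\<close>

lemma coherent_if_finitely_presented:
  assumes "coherent_ring R" and "finitely_presented R X"
  shows "coherent_module R X"
  unfolding coherent_module_def
proof (intro conjI allI ballI)
  have R: "cring R" using assms by (simp add: coherent_ring_def)
  note F = free_module_is_module[OF R]
  obtain n S q where q: "finite_presentation R n S q X"
    using assms(2) by (auto simp: finitely_presented_def)
  show X: "module R X" using q by (simp add: finite_presentation_def)
  have q_hom: "q \<in> module_hom R (free_module R n) X"
    and q_onto: "q ` carrier (free_module R n) = carrier X"
    and S: "finite S" "S \<subseteq> carrier (free_module R n)"
      "mod_hom.ker (free_module R n) X q = module.span R (free_module R n) S"
    using q by (auto simp: finite_presentation_def)
  let ?K = "{w \<in> carrier (free_module R n). q w = \<zero>\<^bsub>X\<^esub>}"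
  have K: "fg_submodule R (free_module R n) ?K"
    unfolding ker_eq[OF F X q_hom, symmetric] S(3) using S(1,2) by (rule fg_submodule_span[OF F])
  fix m f assume f: "f \<in> module_hom R (free_module R m) X"
  obtain h where h: "h \<in> module_hom R (free_module R m) (free_module R n)"
    "\<And>v. v \<in> carrier (free_module R m) \<Longrightarrow> q (h v) = f v"
    using free_module_lift[OF R F X q_hom f] module_hom_closed[OF f] q_onto
    by (auto simp: image_subset_iff_funcset)
  have "{v \<in> carrier (free_module R m). f v = \<zero>\<^bsub>X\<^esub>} = {v \<in> carrier (free_module R m). h v \<in> ?K}"
    using h module_hom_mem[OF h(1)] by auto
  then show "fg_submodule R (free_module R m) {v \<in> carrier (free_module R m). f v = \<zero>\<^bsub>X\<^esub>}"
    using fg_preimage_free_module[OF R coherent_free_module[OF assms(1)] K h(1)] by simp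
qed

lemma fg_preimage:
  fixes X :: "('a, 'b) module" and Z :: "('a, 'c) module"
  assumes R: "cring R" and X: "coherent_module R X" and K: "fg_submodule R X K"
    and Z: "module R Z" and h: "h \<in> module_hom R Z X" and A: "fg_submodule R Z A"
  shows "fg_submodule R Z {a \<in> A. h a \<in> K}"
proof -
  obtain n f where f: "f \<in> module_hom R (free_module R n) Z" "f ` carrier (free_module R n) = A"
    using A unfolding fg_submodule_iff_image[OF R Z] by blast
  have "fg_submodule R Z (f ` {v \<in> carrier (free_module R n). h (f v) \<in> K})"
    by (intro fg_submodule_image[OF free_module_is_module[OF R] Z f(1)]
        fg_preimage_free_module[OF R X K] module_hom_comp[OF f(1) h])
  also have "f ` {v \<in> carrier (free_module R n). h (f v) \<in> K} = {a \<in> A. h a \<in> K}"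
    unfolding f(2)[symmetric] by auto
  finally show ?thesis .
qed

text \<open>
  This realises \<open>A/B\<close> on the type \<open>'m\<close>. With \<open>A\<close> the image of \<open>R^n\<close>, the preimage of \<open>B\<close> in \<open>R^n\<close> is
  finitely generated by coherence, so \<open>A/B\<close> has a finite presentation and therefore a copy on \<open>'m\<close>.
\<close>

lemma finitely_presented_quotient_exists:
  fixes X :: "('a, 'b) module"
  assumes R: "cring R" and carries: "carries_all_fp R TYPE('m)" and X: "coherent_module R X"
    and A: "fg_submodule R X A" and B: "fg_submodule R X B"
  shows "\<exists>Q \<in> (fp_modules R :: ('a, 'm) module set). \<exists>g \<in> module_hom R (X\<lparr>carrier := A\<rparr>) Q.
    g ` A = carrier Q \<and> (\<forall>a \<in> A. g a = \<zero>\<^bsub>Q\<^esub> \<longleftrightarrow> a \<in> B)"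
proof -
  note X' = coherent_module_is_module[OF X]
  obtain n f where f: "f \<in> module_hom R (free_module R n) X" "f ` carrier (free_module R n) = A"
    using A unfolding fg_submodule_iff_image[OF R X'] by blast
  note F = free_module_is_module[OF R, of n]
  obtain S where S: "finite S" "S \<subseteq> carrier (free_module R n)"
    "{v \<in> carrier (free_module R n). f v \<in> B} = module.span R (free_module R n) S"
    using fg_preimage_free_module[OF R X B f(1)] unfolding fg_submodule_iff_span[OF F] by blast
  then obtain p and Q :: "('a, 'm) module" where p: "finite_presentation R n S p Q"
    using carries unfolding carries_all_fp_def by blast
  then have Q: "Q \<in> fp_modules R"
    by (auto simp: fp_modules_def finitely_presented_def)
  have Q': "module R Q" and p_hom: "p \<in> module_hom R (free_module R n) Q"
    and p_onto: "p ` carrier (free_module R n) = carrier Q"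
    and p_ker: "mod_hom.ker (free_module R n) Q p = module.span R (free_module R n) S"
    using p by (auto simp: finite_presentation_def)
  have p0: "p v = \<zero>\<^bsub>Q\<^esub> \<longleftrightarrow> f v \<in> B" if "v \<in> carrier (free_module R n)" for v
    using p_ker that unfolding ker_eq[OF F Q' p_hom] S(3)[symmetric] by blast
  have A': "module R (X\<lparr>carrier := A\<rparr>)"
    by (rule module.submodule_is_module[OF X' fg_submodule_is_submodule[OF X' A]])
  have fA: "f \<in> module_hom R (free_module R n) (X\<lparr>carrier := A\<rparr>)"
    using f by (intro module_hom_onto_image) auto
  have "\<zero>\<^bsub>X\<^esub> \<in> B"
    using submodule.zero_closed[OF fg_submodule_is_submodule[OF X' B]] .
  then obtain g where g: "g \<in> module_hom R (X\<lparr>carrier := A\<rparr>) Q"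
    "\<And>v. v \<in> carrier (free_module R n) \<Longrightarrow> g (f v) = p v"
    using module_hom_factor[OF F A' Q' fA _ p_hom] f(2) p0 by auto
  have "g ` A = carrier Q"
    unfolding f(2)[symmetric] p_onto[symmetric] image_image using g(2) by (intro image_cong) auto
  moreover have "g a = \<zero>\<^bsub>Q\<^esub> \<longleftrightarrow> a \<in> B" if a: "a \<in> A" for a
  proof -
    obtain v where "v \<in> carrier (free_module R n)" "a = f v"
      using a unfolding f(2)[symmetric] by blast
    then show ?thesis using g(2) p0 by simp
  qed
  ultimately show ?thesis using Q g(1) by blast
qed

lemma set_add_upper:
  assumes "submodule R A X" "submodule R B X"
  shows "A \<subseteq> A <+>\<^bsub>X\<^esub> B" and "B \<subseteq> A <+>\<^bsub>X\<^esub> B"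
proof -
  interpret A: submodule R A X by fact
  interpret B: submodule R B X by fact
  interpret module R X by (rule A.module)
  show "A \<subseteq> A <+>\<^bsub>X\<^esub> B"
  proof
    fix a assume a: "a \<in> A"
    then have "a = a \<oplus>\<^bsub>X\<^esub> \<zero>\<^bsub>X\<^esub>" using A.subset by auto
    then show "a \<in> A <+>\<^bsub>X\<^esub> B" unfolding set_add_def' using a B.zero_closed by blast
  qed
  show "B \<subseteq> A <+>\<^bsub>X\<^esub> B"
  proof
    fix b assume b: "b \<in> B"
    then have "b = \<zero>\<^bsub>X\<^esub> \<oplus>\<^bsub>X\<^esub> b" using B.subset by auto
    then show "b \<in> A <+>\<^bsub>X\<^esub> B" unfolding set_add_def' using b A.zero_closed by blast
  qed
qed

lemma set_add_least:
  assumes "submodule R L X" "A \<subseteq> L" "B \<subseteq> L"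
  shows "A <+>\<^bsub>X\<^esub> B \<subseteq> L"
proof -
  interpret L: submodule R L X by fact
  show ?thesis using assms(2,3) by (auto simp: set_add_def')
qed

lemma module_hom_inj_on:
  assumes "module R X" "module R Y" "f \<in> module_hom R X Y"
    and "\<And>x. x \<in> carrier X \<Longrightarrow> f x = \<zero>\<^bsub>Y\<^esub> \<Longrightarrow> x = \<zero>\<^bsub>X\<^esub>"
  shows "inj_on f (carrier X)"
proof (rule inj_onI)
  interpret mod_hom R X Y f by (intro mod_homI assms)
  fix x y assume xy: "x \<in> carrier X" "y \<in> carrier X" "f x = f y"
  then have "f (x \<ominus>\<^bsub>X\<^esub> y) = \<zero>\<^bsub>Y\<^esub>" by simp
  then have "x \<ominus>\<^bsub>X\<^esub> y = \<zero>\<^bsub>X\<^esub>" using xy by (intro assms(4)) auto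
  then show "x = y" using xy by simp
qed

section \<open>Subquotients in a torsion class\<close>

text \<open>
  \<open>A/B\<close> lies in \<open>T\<close> up to isomorphism. Speaking of pairs of submodules of one module avoids
  iterated quotients, each of which would live on a new type.
\<close>

definition subquotient_in ::
    "('a, 'r) ring_scheme \<Rightarrow> ('a, 'm) module set \<Rightarrow> ('a, 'b) module \<Rightarrow> 'b set \<Rightarrow> 'b set \<Rightarrow> bool"
  where "subquotient_in R T X A B \<longleftrightarrow> (\<exists>Q \<in> T. \<exists>g \<in> module_hom R (X\<lparr>carrier := A\<rparr>) Q.
    g ` A = carrier Q \<and> (\<forall>a \<in> A. g a = \<zero>\<^bsub>Q\<^esub> \<longleftrightarrow> a \<in> B))"

definition colon :: "('a, 'r) ring_scheme \<Rightarrow> ('a, 'b) module \<Rightarrow> 'b set \<Rightarrow> 'a set"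
  where "colon R X K = {r \<in> carrier R. \<forall>x \<in> carrier X. r \<odot>\<^bsub>X\<^esub> x \<in> K}"

locale coherent_torsion_class =
  fixes R :: "('a, 'r) ring_scheme" and T :: "('a, 'm) module set"
  assumes coherent: "coherent_ring R"
    and carries: "carries_all_fp R TYPE('m)"
    and torsion: "torsion_class R T"
begin

sublocale R: cring R
  using coherent by (simp add: coherent_ring_def)

lemma T_fp: "Q \<in> T \<Longrightarrow> finitely_presented R Q"
  using torsion by (auto simp: torsion_class_def subcategory_def fp_modules_def)

lemma T_module: "Q \<in> T \<Longrightarrow> module R Q"
  using T_fp by (auto simp: finitely_presented_def finite_presentation_def)

lemma regular: "module R (regular_module R)"
  by (rule regular_module_is_module) (rule R.is_cring)

text \<open>
  Closure under quotients: \<open>h\<close> induces a surjection \<open>A/C \<rightarrow> A'/D\<close> where \<open>A' = h(A) + D\<close>.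
\<close>

lemma subquotient_in_image:
  fixes X :: "('a, 'b) module" and Y :: "('a, 'c) module"
  assumes X: "module R X" and Y: "coherent_module R Y" and h: "h \<in> module_hom R X Y"
    and A: "submodule R A X" and A': "fg_submodule R Y A'" and D: "fg_submodule R Y D"
    and "h ` A \<subseteq> A'" "h ` C \<subseteq> D" "D \<subseteq> A'"
    and sum: "\<And>y. y \<in> A' \<Longrightarrow> \<exists>a \<in> A. \<exists>d \<in> D. y = h a \<oplus>\<^bsub>Y\<^esub> d"
    and "subquotient_in R T X A C"
  shows "subquotient_in R T Y A' D"
proof -
  obtain Q g where Q: "Q \<in> T" "g \<in> module_hom R (X\<lparr>carrier := A\<rparr>) Q" "g ` A = carrier Q"
    "\<And>a. a \<in> A \<Longrightarrow> g a = \<zero>\<^bsub>Q\<^esub> \<longleftrightarrow> a \<in> C"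
    using assms(11) unfolding subquotient_in_def by blast
  obtain Q' :: "('a, 'm) module" and g' where Q': "Q' \<in> fp_modules R"
    "g' \<in> module_hom R (Y\<lparr>carrier := A'\<rparr>) Q'" "g' ` A' = carrier Q'"
    "\<And>a. a \<in> A' \<Longrightarrow> g' a = \<zero>\<^bsub>Q'\<^esub> \<longleftrightarrow> a \<in> D"
    using finitely_presented_quotient_exists[OF R.is_cring carries Y A' D] by blast
  have mQ': "module R Q'"
    using Q'(1) by (auto simp: fp_modules_def finitely_presented_def finite_presentation_def)
  interpret Q': module R Q' by (rule mQ')
  have "h \<in> module_hom R (X\<lparr>carrier := A\<rparr>) (Y\<lparr>carrier := A'\<rparr>)"
    using assms(7) submodule.subset[OF A] by (intro module_hom_onto_image module_hom_restrict h) auto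
  from module_hom_comp[OF this Q'(2)]
  have hg': "(\<lambda>a. g' (h a)) \<in> module_hom R (X\<lparr>carrier := A\<rparr>) Q'" .
  have "\<exists>\<phi> \<in> module_hom R Q Q'. \<forall>a \<in> carrier (X\<lparr>carrier := A\<rparr>). \<phi> (g a) = g' (h a)"
  proof (rule module_hom_factor[OF module.submodule_is_module[OF X A] T_module[OF Q(1)] mQ' Q(2) _ hg'])
    fix a assume "a \<in> carrier (X\<lparr>carrier := A\<rparr>)" "g a = \<zero>\<^bsub>Q\<^esub>"
    then have "h a \<in> A'" "h a \<in> D" using assms(7,8) Q(4) by auto
    then show "g' (h a) = \<zero>\<^bsub>Q'\<^esub>" using Q'(4) by simp
  qed (simp add: Q(3))
  then obtain \<phi> where \<phi>: "\<phi> \<in> module_hom R Q Q'" "\<And>a. a \<in> A \<Longrightarrow> \<phi> (g a) = g' (h a)"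
    by auto
  have "\<phi> ` carrier Q = carrier Q'"
  proof
    show "\<phi> ` carrier Q \<subseteq> carrier Q'" using module_hom_mem[OF \<phi>(1)] by blast
    show "carrier Q' \<subseteq> \<phi> ` carrier Q"
    proof
      fix q assume "q \<in> carrier Q'"
      then obtain y where y: "y \<in> A'" "q = g' y" unfolding Q'(3)[symmetric] by blast
      then obtain a d where ad: "a \<in> A" "d \<in> D" "y = h a \<oplus>\<^bsub>Y\<^esub> d" using sum by blast
      have "h a \<in> A'" "d \<in> A'" using ad assms(7,9) by auto
      then have "q = g' (h a) \<oplus>\<^bsub>Q'\<^esub> g' d"
        using module_hom_add[OF Q'(2), of "h a" d] y ad by simp
      moreover have "g' d = \<zero>\<^bsub>Q'\<^esub>" using Q'(4)[OF \<open>d \<in> A'\<close>] ad(2) by simp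
      moreover have "g' (h a) \<in> carrier Q'" using Q'(3) \<open>h a \<in> A'\<close> by blast
      ultimately have "q = \<phi> (g a)" using \<phi>(2)[OF ad(1)] by simp
      then show "q \<in> \<phi> ` carrier Q"
        using ad(1) Q(3) by blast
    qed
  qed
  then have "Q' \<in> T"
    using torsion Q(1) Q'(1) \<phi>(1) unfolding torsion_class_def closed_under_quotients_def by blast
  then show ?thesis
    unfolding subquotient_in_def using Q' by blast
qed

text \<open>
  Here \<open>h\<close> induces an isomorphism \<open>A/C \<rightarrow> A'/D\<close>, and membership moves to its source. The case where
  \<open>h\<close> is the identity is the isomorphism of \<open>A/(A \<inter> D)\<close> with \<open>(A + D)/D\<close>.
\<close>

lemma subquotient_in_preimage:
  assumes h: "h \<in> module_hom R X Y" and "A \<subseteq> carrier X"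
    and "h ` A \<subseteq> A'" "D \<subseteq> A'"
    and sum: "\<And>y. y \<in> A' \<Longrightarrow> \<exists>a \<in> A. \<exists>d \<in> D. y = h a \<oplus>\<^bsub>Y\<^esub> d"
    and C: "\<And>a. a \<in> A \<Longrightarrow> h a \<in> D \<longleftrightarrow> a \<in> C"
    and "subquotient_in R T Y A' D"
  shows "subquotient_in R T X A C"
proof -
  obtain Q g where Q: "Q \<in> T" "g \<in> module_hom R (Y\<lparr>carrier := A'\<rparr>) Q" "g ` A' = carrier Q"
    "\<And>a. a \<in> A' \<Longrightarrow> g a = \<zero>\<^bsub>Q\<^esub> \<longleftrightarrow> a \<in> D"
    using assms(7) unfolding subquotient_in_def by blast
  interpret Q: module R Q by (rule T_module[OF Q(1)])
  have "h \<in> module_hom R (X\<lparr>carrier := A\<rparr>) (Y\<lparr>carrier := A'\<rparr>)"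
    using assms(2,3) by (intro module_hom_onto_image module_hom_restrict h) auto
  from module_hom_comp[OF this Q(2)]
  have gh: "(\<lambda>a. g (h a)) \<in> module_hom R (X\<lparr>carrier := A\<rparr>) Q" .
  have "(\<lambda>a. g (h a)) ` A = carrier Q"
  proof
    show "(\<lambda>a. g (h a)) ` A \<subseteq> carrier Q" using module_hom_mem[OF gh] by auto
    show "carrier Q \<subseteq> (\<lambda>a. g (h a)) ` A"
    proof
      fix q assume "q \<in> carrier Q"
      then obtain y where y: "y \<in> A'" "q = g y" unfolding Q(3)[symmetric] by blast
      then obtain a d where ad: "a \<in> A" "d \<in> D" "y = h a \<oplus>\<^bsub>Y\<^esub> d" using sum by blast
      have "h a \<in> A'" "d \<in> A'" using ad assms(3,4) by auto
      then have "q = g (h a) \<oplus>\<^bsub>Q\<^esub> g d"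
        using module_hom_add[OF Q(2), of "h a" d] y ad by simp
      moreover have "g d = \<zero>\<^bsub>Q\<^esub>" using Q(4)[OF \<open>d \<in> A'\<close>] ad(2) by simp
      moreover have "g (h a) \<in> carrier Q" using Q(3) \<open>h a \<in> A'\<close> by blast
      ultimately have "q = g (h a)" by simp
      then show "q \<in> (\<lambda>a. g (h a)) ` A" using ad(1) by blast
    qed
  qed
  moreover have "\<forall>a \<in> A. g (h a) = \<zero>\<^bsub>Q\<^esub> \<longleftrightarrow> a \<in> C"
    using assms(3) C Q(4) by blast
  ultimately show ?thesis
    unfolding subquotient_in_def using Q(1) gh by (intro bexI[of _ Q] bexI[of _ "\<lambda>a. g (h a)"]) auto
qed

text \<open>
  Closure under extensions, applied to \<open>B/C \<rightarrow> A/C \<rightarrow> A/B\<close>.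
\<close>

lemma subquotient_in_extension:
  fixes X :: "('a, 'b) module"
  assumes X: "coherent_module R X"
    and A: "fg_submodule R X A" and B: "fg_submodule R X B" and C: "fg_submodule R X C"
    and "C \<subseteq> B" "B \<subseteq> A"
    and AB: "subquotient_in R T X A B" and BC: "subquotient_in R T X B C"
  shows "subquotient_in R T X A C"
proof -
  note X' = coherent_module_is_module[OF X]
  note mA = module.submodule_is_module[OF X' fg_submodule_is_submodule[OF X' A]]
    and mB = module.submodule_is_module[OF X' fg_submodule_is_submodule[OF X' B]]
  obtain N n where N: "N \<in> T" "n \<in> module_hom R (X\<lparr>carrier := A\<rparr>) N" "n ` A = carrier N"
    "\<And>a. a \<in> A \<Longrightarrow> n a = \<zero>\<^bsub>N\<^esub> \<longleftrightarrow> a \<in> B"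
    using AB unfolding subquotient_in_def by blast
  obtain L l where L: "L \<in> T" "l \<in> module_hom R (X\<lparr>carrier := B\<rparr>) L" "l ` B = carrier L"
    "\<And>a. a \<in> B \<Longrightarrow> l a = \<zero>\<^bsub>L\<^esub> \<longleftrightarrow> a \<in> C"
    using BC unfolding subquotient_in_def by blast
  obtain M :: "('a, 'm) module" and m where M: "M \<in> fp_modules R"
    "m \<in> module_hom R (X\<lparr>carrier := A\<rparr>) M" "m ` A = carrier M"
    "\<And>a. a \<in> A \<Longrightarrow> m a = \<zero>\<^bsub>M\<^esub> \<longleftrightarrow> a \<in> C"
    using finitely_presented_quotient_exists[OF R.is_cring carries X A C] by blast
  have mM: "module R M"
    using M(1) by (auto simp: fp_modules_def finitely_presented_def finite_presentation_def)
  note mN = T_module[OF N(1)] and mL = T_module[OF L(1)]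
  have "m \<in> module_hom R (X\<lparr>carrier := B\<rparr>) M"
    using module_hom_restrict[OF M(2), of B] assms(6) by simp
  then have "\<exists>i \<in> module_hom R L M. \<forall>b \<in> carrier (X\<lparr>carrier := B\<rparr>). i (l b) = m b"
    using assms(6) by (intro module_hom_factor[OF mB mL mM L(2)]) (auto simp: L(3,4) M(4) subset_iff)
  then obtain i where i: "i \<in> module_hom R L M" "\<And>b. b \<in> B \<Longrightarrow> i (l b) = m b"
    by auto
  have "\<exists>p \<in> module_hom R M N. \<forall>a \<in> carrier (X\<lparr>carrier := A\<rparr>). p (m a) = n a"
    using assms(5) by (intro module_hom_factor[OF mA mM mN M(2) _ N(2)]) (auto simp: M(3,4) N(4) subset_iff)
  then obtain p where p: "p \<in> module_hom R M N" "\<And>a. a \<in> A \<Longrightarrow> p (m a) = n a"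
    by auto
  have "short_exact R L i M p N"
    unfolding short_exact_def
  proof (intro conjI i p)
    show "inj_on i (carrier L)"
    proof (rule module_hom_inj_on[OF mL mM i(1)])
      fix x assume "x \<in> carrier L" "i x = \<zero>\<^bsub>M\<^esub>"
      moreover from this obtain b where "b \<in> B" "x = l b" unfolding L(3)[symmetric] by blast
      ultimately show "x = \<zero>\<^bsub>L\<^esub>" using i(2) L(4) M(4) assms(6) by auto
    qed
    show "i ` carrier L = mod_hom.ker M N p"
      unfolding ker_eq[OF mM mN p(1)]
    proof
      show "i ` carrier L \<subseteq> {x \<in> carrier M. p x = \<zero>\<^bsub>N\<^esub>}"
        unfolding L(3)[symmetric] using i p M(3) N(4) assms(6) by (auto simp: subset_iff)
      show "{x \<in> carrier M. p x = \<zero>\<^bsub>N\<^esub>} \<subseteq> i ` carrier L"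
      proof clarify
        fix x assume x: "x \<in> carrier M" "p x = \<zero>\<^bsub>N\<^esub>"
        then obtain a where a: "a \<in> A" "x = m a" unfolding M(3)[symmetric] by blast
        then have "a \<in> B" using x p(2) N(4) by simp
        then show "x \<in> i ` carrier L"
          using a i(2) L(3) by (metis imageI)
      qed
    qed
    show "p ` carrier M = carrier N"
      unfolding M(3)[symmetric] N(3)[symmetric] image_image using p(2) by (intro image_cong) auto
  qed
  then have "M \<in> T"
    using torsion L(1) N(1) M(1) unfolding torsion_class_def closed_under_extensions_def by blast
  then show ?thesis
    unfolding subquotient_in_def using M by blast
qed

lemma module_hom_carrier_update: "module_hom R (X\<lparr>carrier := carrier X\<rparr>) Y = module_hom R X Y"
  by (simp add: module_hom_def)

lemma subquotient_in_self:
  assumes "Q \<in> T"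
  shows "subquotient_in R T Q (carrier Q) {\<zero>\<^bsub>Q\<^esub>}"
  unfolding subquotient_in_def module_hom_carrier_update
  using assms by (intro bexI[of _ Q] bexI[of _ "\<lambda>x. x"] module_hom_id) auto

text \<open>
  The zero module belongs to \<open>T\<close>, being the image of any member under the zero map.
\<close>

lemma subquotient_in_trivial:
  assumes X: "coherent_module R X" and K: "fg_submodule R X K"
  shows "subquotient_in R T X K K"
proof -
  obtain Q where Q: "Q \<in> T"
    using torsion by (auto simp: torsion_class_def subcategory_def)
  note X' = coherent_module_is_module[OF X] and mQ = T_module[OF Q]
  interpret X: module R X by (rule X')
  interpret Q: module R Q by (rule mQ)
  interpret K: submodule R K X by (rule fg_submodule_is_submodule[OF X' K])
  show ?thesis
  proof (rule subquotient_in_image[OF mQ X _ carrier_submodule[OF mQ] K K _ _ _ _ subquotient_in_self[OF Q]])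
    show "(\<lambda>_. \<zero>\<^bsub>X\<^esub>) \<in> module_hom R Q X" by (intro module_homI) auto
    show "\<exists>a \<in> carrier Q. \<exists>d \<in> K. y = \<zero>\<^bsub>X\<^esub> \<oplus>\<^bsub>X\<^esub> d" if "y \<in> K" for y
      using that K.subset Q.M.zero_closed by (intro bexI[of _ "\<zero>\<^bsub>Q\<^esub>"] bexI[of _ y]) auto
  qed auto
qed

lemma subquotient_in_larger:
  assumes X: "coherent_module R X" and A: "fg_submodule R X A" and K': "fg_submodule R X K'"
    and "K \<subseteq> K'" "K' \<subseteq> A" and "subquotient_in R T X A K"
  shows "subquotient_in R T X A K'"
proof -
  note X' = coherent_module_is_module[OF X]
  interpret X: module R X by (rule X')
  interpret K': submodule R K' X by (rule fg_submodule_is_submodule[OF X' K'])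
  interpret A: submodule R A X by (rule fg_submodule_is_submodule[OF X' A])
  show ?thesis
  proof (rule subquotient_in_image[OF X' X module_hom_id A.submodule_axioms A K' _ _ _ _ assms(6)])
    show "\<exists>a \<in> A. \<exists>d \<in> K'. y = a \<oplus>\<^bsub>X\<^esub> d" if "y \<in> A" for y
      using that A.subset K'.zero_closed by (intro bexI[of _ y] bexI[of _ "\<zero>\<^bsub>X\<^esub>"]) auto
  qed (use assms(4,5) in auto)
qed

text \<open>
  The cyclic module \<open>(B + Rx)/B\<close> is a quotient of \<open>R/I\<close> as soon as \<open>I\<close> kills it.
\<close>

lemma subquotient_in_adjoin:
  assumes X: "coherent_module R X" and B: "fg_submodule R X B" and x: "x \<in> carrier X"
    and I: "subquotient_in R T (regular_module R) (carrier R) I"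
    and "\<And>r. r \<in> I \<Longrightarrow> r \<odot>\<^bsub>X\<^esub> x \<in> B"
  shows "subquotient_in R T X (adjoin R X B x) B"
proof -
  note X' = coherent_module_is_module[OF X]
  interpret X: module R X by (rule X')
  interpret B: submodule R B X by (rule fg_submodule_is_submodule[OF X' B])
  note sub = subset_adjoin[OF B.submodule_axioms x]
  interpret A: submodule R "adjoin R X B x" X by (rule adjoin_submodule[OF B.submodule_axioms x])
  show ?thesis
  proof (rule subquotient_in_image[OF regular X module_hom_smult_right[OF X' x] _ _ B _ _ _ _ I])
    show "submodule R (carrier R) (regular_module R)"
      using carrier_submodule[OF regular] by simp
    show "fg_submodule R X (adjoin R X B x)" by (rule fg_submodule.adjoin[OF B x])
    show "\<exists>r \<in> carrier R. \<exists>b \<in> B. y = r \<odot>\<^bsub>X\<^esub> x \<oplus>\<^bsub>X\<^esub> b" if y: "y \<in> adjoin R X B x" for y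
    proof -
      obtain b r where br: "b \<in> B" "r \<in> carrier R" "y = b \<oplus>\<^bsub>X\<^esub> r \<odot>\<^bsub>X\<^esub> x"
        using y by (auto simp: adjoin_def)
      then have "y = r \<odot>\<^bsub>X\<^esub> x \<oplus>\<^bsub>X\<^esub> b"
        using B.subset x X.M.a_comm by auto
      then show ?thesis using br by blast
    qed
  qed (use sub assms(5) in auto)
qed

text \<open>
  If \<open>X/K\<close> is in \<open>T\<close>, so is \<open>(JX + K)/K\<close> for each finitely generated ideal \<open>J\<close>. For \<open>J = B + Ra\<close> the
  submodule \<open>A = JX + K\<close> arises from \<open>BX + K\<close> by adding \<open>aX\<close>, and multiplication by \<open>a\<close> maps \<open>X/K\<close> onto
  the new factor; extensions do the rest. The submodule \<open>JX + K\<close> is described by its universal property,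
  as the least one containing \<open>K\<close> and all products.
\<close>

lemma subquotient_in_ideal_times:
  assumes X: "coherent_module R X" and fgX: "fg_submodule R X (carrier X)"
    and K: "fg_submodule R X K" and XK: "subquotient_in R T X (carrier X) K"
    and "fg_submodule R (regular_module R) J"
  shows "\<exists>A. fg_submodule R X A \<and> K \<subseteq> A \<and> (\<forall>j \<in> J. \<forall>x \<in> carrier X. j \<odot>\<^bsub>X\<^esub> x \<in> A) \<and>
    (\<forall>L. submodule R L X \<longrightarrow> K \<subseteq> L \<longrightarrow> (\<forall>j \<in> J. \<forall>x \<in> carrier X. j \<odot>\<^bsub>X\<^esub> x \<in> L) \<longrightarrow> A \<subseteq> L) \<and>
    subquotient_in R T X A K"
  using assms(5)
proof induction
  note X' = coherent_module_is_module[OF X]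
  interpret X: module R X by (rule X')
  interpret K: submodule R K X by (rule fg_submodule_is_submodule[OF X' K])
  {
    case zero
    show ?case
      using K subquotient_in_trivial[OF X K] by (intro exI[of _ K]) auto
  next
    case (adjoin B a)
    then have a: "a \<in> carrier R" by simp
    interpret B: submodule R B "regular_module R" by (rule fg_submodule_is_submodule[OF regular adjoin.hyps(1)])
    have adj: "B \<subseteq> adjoin R (regular_module R) B a" "a \<in> adjoin R (regular_module R) B a"
      using subset_adjoin[OF B.submodule_axioms] a by auto
    obtain A where A: "fg_submodule R X A" "K \<subseteq> A" "\<forall>j \<in> B. \<forall>x \<in> carrier X. j \<odot>\<^bsub>X\<^esub> x \<in> A"
      and least: "\<And>L. submodule R L X \<Longrightarrow> K \<subseteq> L \<Longrightarrow> \<forall>j \<in> B. \<forall>x \<in> carrier X. j \<odot>\<^bsub>X\<^esub> x \<in> L \<Longrightarrow> A \<subseteq> L"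
      and AK: "subquotient_in R T X A K"
      using adjoin.IH by blast
    let ?aX = "(\<lambda>x. a \<odot>\<^bsub>X\<^esub> x) ` carrier X"
    let ?A = "?aX <+>\<^bsub>X\<^esub> A"
    note a_hom = module_hom_smult_left[OF X' a]
    have aX: "fg_submodule R X ?aX" by (rule fg_submodule_image[OF X' X' a_hom fgX])
    have fgA: "fg_submodule R X ?A" by (rule fg_submodule_sum[OF X' aX A(1)])
    interpret A: submodule R A X by (rule fg_submodule_is_submodule[OF X' A(1)])
    interpret A': submodule R ?A X by (rule fg_submodule_is_submodule[OF X' fgA])
    note upper = set_add_upper[OF fg_submodule_is_submodule[OF X' aX] A.submodule_axioms]
    have "subquotient_in R T X ?A A"
    proof (rule subquotient_in_image[OF X' X a_hom carrier_submodule[OF X'] fgA A(1) _ _ _ _ XK])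
      show "(\<lambda>x. a \<odot>\<^bsub>X\<^esub> x) ` K \<subseteq> A" using A(2) K.smult_closed a by auto
      show "\<exists>x \<in> carrier X. \<exists>d \<in> A. y = a \<odot>\<^bsub>X\<^esub> x \<oplus>\<^bsub>X\<^esub> d" if "y \<in> ?A" for y
        using that by (auto simp: set_add_def')
    qed (use upper in auto)
    then have AK': "subquotient_in R T X ?A K"
      using upper(2) A(2) AK by (intro subquotient_in_extension[OF X fgA A(1) K])
    have "j \<odot>\<^bsub>X\<^esub> x \<in> ?A" if j: "j \<in> adjoin R (regular_module R) B a" and x: "x \<in> carrier X" for j x
    proof -
      obtain b r where br: "b \<in> B" "r \<in> carrier R" "j = b \<oplus>\<^bsub>R\<^esub> r \<otimes>\<^bsub>R\<^esub> a"
        using j by (auto simp: adjoin_def)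
      have b: "b \<in> carrier R" using br(1) B.subset by auto
      have "j \<odot>\<^bsub>X\<^esub> x = b \<odot>\<^bsub>X\<^esub> x \<oplus>\<^bsub>X\<^esub> a \<odot>\<^bsub>X\<^esub> (r \<odot>\<^bsub>X\<^esub> x)"
        using br b a x by (simp add: X.smult_l_distr R.m_comm[of r a] X.smult_assoc1)
      moreover have "b \<odot>\<^bsub>X\<^esub> x \<in> ?A" using A(3) br(1) x upper(2) by blast
      moreover have "a \<odot>\<^bsub>X\<^esub> (r \<odot>\<^bsub>X\<^esub> x) \<in> ?A" using upper(1) br(2) x by blast
      ultimately show ?thesis by simp
    qed
    moreover have "?A \<subseteq> L"
      if "submodule R L X" "K \<subseteq> L" "\<forall>j \<in> adjoin R (regular_module R) B a. \<forall>x \<in> carrier X. j \<odot>\<^bsub>X\<^esub> x \<in> L" for L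
      using that adj by (intro set_add_least least) auto
    ultimately show ?case
      using fgA AK' A(2) upper(2) by (intro exI[of _ ?A]) blast
  }
qed

lemma coherent_R: "coherent_module R (regular_module R)"
  by (rule coherent_regular_module[OF coherent])

lemma fg_R: "fg_submodule R (regular_module R) (carrier R)"
proof -
  have "adjoin R (regular_module R) {\<zero>\<^bsub>R\<^esub>} \<one>\<^bsub>R\<^esub> = carrier R"
    by (auto simp: adjoin_def) (metis R.l_zero R.r_one)
  then show ?thesis
    using fg_submodule.adjoin[OF fg_submodule.zero[of R "regular_module R"], of "\<one>\<^bsub>R\<^esub>"] by simp
qed

section \<open>Quotients by annihilators\<close>

text \<open>
  The kernel of \<open>R/(I \<inter> P) \<rightarrow> R/I\<close> is \<open>I/(I \<inter> P)\<close>, isomorphic to \<open>(I + P)/P\<close>.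
  Since \<open>I + P = IR + P\<close>, the latter is in \<open>T\<close> by
  \<open>subquotient_in_ideal_times\<close>, applied to the module \<open>R\<close>.
\<close>

lemma cyclic_quotient_inter:
  assumes I: "fg_submodule R (regular_module R) I" and P: "fg_submodule R (regular_module R) P"
    and IP: "fg_submodule R (regular_module R) (I \<inter> P)"
    and RI: "subquotient_in R T (regular_module R) (carrier R) I"
    and RP: "subquotient_in R T (regular_module R) (carrier R) P"
  shows "subquotient_in R T (regular_module R) (carrier R) (I \<inter> P)"
proof -
  interpret I: submodule R I "regular_module R" by (rule fg_submodule_is_submodule[OF regular I])
  interpret P: submodule R P "regular_module R" by (rule fg_submodule_is_submodule[OF regular P])
  have I_R: "i \<in> carrier R" if "i \<in> I" for i using that I.subset by auto
  obtain A where A: "fg_submodule R (regular_module R) A" "P \<subseteq> A"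
    "\<And>i r. i \<in> I \<Longrightarrow> r \<in> carrier R \<Longrightarrow> i \<otimes>\<^bsub>R\<^esub> r \<in> A"
    and least: "\<And>L. submodule R L (regular_module R) \<Longrightarrow> P \<subseteq> L \<Longrightarrow>
      (\<And>i r. i \<in> I \<Longrightarrow> r \<in> carrier R \<Longrightarrow> i \<otimes>\<^bsub>R\<^esub> r \<in> L) \<Longrightarrow> A \<subseteq> L"
    and AP: "subquotient_in R T (regular_module R) A P"
    using subquotient_in_ideal_times[OF coherent_R _ P _ I] fg_R RP by auto
  note upper = set_add_upper[OF I.submodule_axioms P.submodule_axioms]
  have "A \<subseteq> I <+>\<^bsub>regular_module R\<^esub> P"
  proof (rule least)
    show "submodule R (I <+>\<^bsub>regular_module R\<^esub> P) (regular_module R)"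
      by (rule fg_submodule_is_submodule[OF regular fg_submodule_sum[OF regular I P]])
    fix i r assume i: "i \<in> I" and r: "r \<in> carrier R"
    have "i \<otimes>\<^bsub>R\<^esub> r \<in> I" using I.smult_closed[OF r i] I_R[OF i] r by (simp add: R.m_comm)
    then show "i \<otimes>\<^bsub>R\<^esub> r \<in> I <+>\<^bsub>regular_module R\<^esub> P" using upper by blast
  qed (use upper in auto)
  then have sum: "\<exists>i \<in> I. \<exists>p \<in> P. y = i \<oplus>\<^bsub>R\<^esub> p" if "y \<in> A" for y
    using that unfolding set_add_def' regular_module_simps by blast
  have "I \<subseteq> A" using A(3)[of _ "\<one>\<^bsub>R\<^esub>"] I_R by auto
  then have "subquotient_in R T (regular_module R) I (I \<inter> P)"
    using I.subset A(2) sum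
    by (intro subquotient_in_preimage[OF module_hom_id _ _ _ _ _ AP]) auto
  then show ?thesis
    using I.subset RI by (intro subquotient_in_extension[OF coherent_R fg_R I IP]) auto
qed

text \<open>
  For one \<open>x\<close>, the ideal of all \<open>r\<close> with \<open>r x \<in> K\<close> is the annihilator of the cyclic module \<open>(K + Rx)/K\<close>,
  so the quotient of \<open>R\<close> by it is isomorphic to that module. The ideals of several elements are
  intersected.
\<close>

lemma quotient_by_colon_of_finite:
  assumes X: "coherent_module R X" and K: "fg_submodule R X K" and "finite S" "S \<subseteq> carrier X"
    and "\<And>x. x \<in> S \<Longrightarrow> subquotient_in R T X (adjoin R X K x) K"
  shows "fg_submodule R (regular_module R) {r \<in> carrier R. \<forall>x \<in> S. r \<odot>\<^bsub>X\<^esub> x \<in> K} \<and>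
    subquotient_in R T (regular_module R) (carrier R) {r \<in> carrier R. \<forall>x \<in> S. r \<odot>\<^bsub>X\<^esub> x \<in> K}"
  using assms(3-5)
proof induction
  case empty
  then show ?case by (simp add: fg_R subquotient_in_trivial coherent_R)
next
  case (insert x S)
  note X' = coherent_module_is_module[OF X]
  interpret X: module R X by (rule X')
  interpret K: submodule R K X by (rule fg_submodule_is_submodule[OF X' K])
  let ?I = "{r \<in> carrier R. \<forall>x \<in> S. r \<odot>\<^bsub>X\<^esub> x \<in> K}" and ?P = "{r \<in> carrier R. r \<odot>\<^bsub>X\<^esub> x \<in> K}"
  have x: "x \<in> carrier X" using insert.prems by simp
  have I: "fg_submodule R (regular_module R) ?I" "subquotient_in R T (regular_module R) (carrier R) ?I"
    using insert by auto
  note h = module_hom_smult_right[OF X' x]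
  have P: "fg_submodule R (regular_module R) ?P"
    using fg_preimage[OF R.is_cring X K regular h fg_R] .
  have "fg_submodule R (regular_module R) {r \<in> ?I. r \<odot>\<^bsub>X\<^esub> x \<in> K}"
    by (rule fg_preimage[OF R.is_cring X K regular h I(1)])
  also have "{r \<in> ?I. r \<odot>\<^bsub>X\<^esub> x \<in> K} = ?I \<inter> ?P" by auto
  finally have IP: "fg_submodule R (regular_module R) (?I \<inter> ?P)" .
  have "subquotient_in R T (regular_module R) (carrier R) ?P"
  proof (rule subquotient_in_preimage[OF h _ _ _ _ _ insert.prems(2)[OF insertI1]])
    show "(\<lambda>r. r \<odot>\<^bsub>X\<^esub> x) ` carrier R \<subseteq> adjoin R X K x"
      using subset_adjoin(2)[OF K.submodule_axioms x]
        submodule.smult_closed[OF adjoin_submodule[OF K.submodule_axioms x]] by auto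
    show "K \<subseteq> adjoin R X K x" by (rule subset_adjoin[OF K.submodule_axioms x])
    show "\<exists>r \<in> carrier R. \<exists>b \<in> K. y = r \<odot>\<^bsub>X\<^esub> x \<oplus>\<^bsub>X\<^esub> b" if y: "y \<in> adjoin R X K x" for y
    proof -
      obtain b r where br: "b \<in> K" "r \<in> carrier R" "y = b \<oplus>\<^bsub>X\<^esub> r \<odot>\<^bsub>X\<^esub> x"
        using y by (auto simp: adjoin_def)
      then have "y = r \<odot>\<^bsub>X\<^esub> x \<oplus>\<^bsub>X\<^esub> b"
        using K.subset x X.M.a_comm by auto
      then show ?thesis using br by blast
    qed
  qed auto
  from cyclic_quotient_inter[OF I(1) P IP I(2) this]
  have "subquotient_in R T (regular_module R) (carrier R) (?I \<inter> ?P)" .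
  moreover have "?I \<inter> ?P = {r \<in> carrier R. \<forall>y \<in> insert x S. r \<odot>\<^bsub>X\<^esub> y \<in> K}" by auto
  ultimately show ?case using IP by simp
qed

text \<open>
  The heart of the proof: the quotient of \<open>R\<close> by the annihilator of \<open>X/K\<close> is in \<open>T\<close>, by induction on a
  set \<open>S\<close> that generates \<open>X\<close> modulo \<open>K\<close>. Allowing an arbitrary \<open>K\<close> lets the induction pass to
  \<open>X/(K + Rx)\<close>, which needs one generator fewer, without changing the module.
\<close>

lemma quotient_by_colon:
  assumes X: "coherent_module R X" and fgX: "fg_submodule R X (carrier X)"
    and "finite S" and "S \<subseteq> carrier X" and "fg_submodule R X K"
    and "\<And>L. submodule R L X \<Longrightarrow> K \<subseteq> L \<Longrightarrow> S \<subseteq> L \<Longrightarrow> carrier X \<subseteq> L"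
    and "subquotient_in R T X (carrier X) K"
  shows "fg_submodule R (regular_module R) (colon R X K) \<and>
    subquotient_in R T (regular_module R) (carrier R) (colon R X K)"
  using assms(3-)
proof (induction S arbitrary: K rule: finite_psubset_induct)
  case (psubset S)
  note S = psubset.prems(1) and K = psubset.prems(2) and gen = psubset.prems(3) and XK = psubset.prems(4)
  note X' = coherent_module_is_module[OF X]
  interpret X: module R X by (rule X')
  interpret K: submodule R K X by (rule fg_submodule_is_submodule[OF X' K])
  have "subquotient_in R T X (adjoin R X K x) K" if x: "x \<in> S" for x
  proof -
    have xX: "x \<in> carrier X" using x S by auto
    let ?K = "adjoin R X K x"
    have fgK: "fg_submodule R X ?K" by (rule fg_submodule.adjoin[OF K xX])
    interpret K': submodule R ?K X by (rule fg_submodule_is_submodule[OF X' fgK])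
    note adj = subset_adjoin[OF K.submodule_axioms xX]
    have XK': "subquotient_in R T X (carrier X) ?K"
      using subquotient_in_larger[OF X fgX fgK adj(1) K'.subset XK] .
    \<comment> \<open>the ideal \<open>J\<close> is the annihilator of \<open>X/(K + Rx)\<close>; the elements of \<open>S\<close> other than \<open>x\<close> generate this module\<close>
    have IH: "fg_submodule R (regular_module R) (colon R X ?K) \<and>
      subquotient_in R T (regular_module R) (carrier R) (colon R X ?K)"
      using x S adj by (intro psubset.IH[of "S - {x}", OF _ _ fgK gen XK']) auto
    then have J: "fg_submodule R (regular_module R) (colon R X ?K)"
      and RJ: "subquotient_in R T (regular_module R) (carrier R) (colon R X ?K)" by auto
    obtain A where A: "fg_submodule R X A" "K \<subseteq> A"
      "\<And>j y. j \<in> colon R X ?K \<Longrightarrow> y \<in> carrier X \<Longrightarrow> j \<odot>\<^bsub>X\<^esub> y \<in> A"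
      and least: "\<And>L. submodule R L X \<Longrightarrow> K \<subseteq> L \<Longrightarrow>
        (\<And>j y. j \<in> colon R X ?K \<Longrightarrow> y \<in> carrier X \<Longrightarrow> j \<odot>\<^bsub>X\<^esub> y \<in> L) \<Longrightarrow> A \<subseteq> L"
      and AK: "subquotient_in R T X A K"
      using subquotient_in_ideal_times[OF X fgX K XK J] by auto
    interpret A: submodule R A X by (rule fg_submodule_is_submodule[OF X' A(1)])
    \<comment> \<open>\<open>A = JX + K\<close> splits \<open>(K + Rx)/K\<close>: the lower part \<open>A/K\<close> comes from \<open>X/K\<close>,
      the upper part \<open>(K + Rx)/A\<close> is cyclic and killed by \<open>J\<close>\<close>
    have AK': "A \<subseteq> ?K"
      using adj by (intro least K'.submodule_axioms) (auto simp: colon_def)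
    have "adjoin R X A x = ?K"
    proof
      show "adjoin R X A x \<subseteq> ?K" by (rule adjoin_subset[OF K'.submodule_axioms AK' adj(2)])
      show "?K \<subseteq> adjoin R X A x" using A(2) by (auto simp: adjoin_def)
    qed
    then have "subquotient_in R T X ?K A"
      using subquotient_in_adjoin[OF X A(1) xX RJ] A(3) xX by simp
    then show ?thesis
      by (rule subquotient_in_extension[OF X fgK A(1) K A(2) AK' _ AK])
  qed
  from quotient_by_colon_of_finite[OF X K psubset.hyps S this]
  have *: "fg_submodule R (regular_module R) {r \<in> carrier R. \<forall>x \<in> S. r \<odot>\<^bsub>X\<^esub> x \<in> K} \<and>
    subquotient_in R T (regular_module R) (carrier R) {r \<in> carrier R. \<forall>x \<in> S. r \<odot>\<^bsub>X\<^esub> x \<in> K}" .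
  have "{r \<in> carrier R. \<forall>x \<in> S. r \<odot>\<^bsub>X\<^esub> x \<in> K} = colon R X K"
  proof
    show "colon R X K \<subseteq> {r \<in> carrier R. \<forall>x \<in> S. r \<odot>\<^bsub>X\<^esub> x \<in> K}"
      using S by (auto simp: colon_def)
    show "{r \<in> carrier R. \<forall>x \<in> S. r \<odot>\<^bsub>X\<^esub> x \<in> K} \<subseteq> colon R X K"
    proof clarify
      fix r assume r: "r \<in> carrier R" "\<forall>x \<in> S. r \<odot>\<^bsub>X\<^esub> x \<in> K"
      \<comment> \<open>an element that maps the generators into \<open>K\<close> maps all of \<open>X\<close> into \<open>K\<close>\<close>
      have "carrier X \<subseteq> {y \<in> carrier X. r \<odot>\<^bsub>X\<^esub> y \<in> K}"
        using r S K.subset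
        by (intro gen preimage_submodule[OF X' X' module_hom_smult_left[OF X' r(1)] K.submodule_axioms]) auto
      then show "r \<in> colon R X K" using r(1) by (auto simp: colon_def)
    qed
  qed
  with * show ?case by simp
qed

lemma fg_carrier:
  assumes "finitely_presented R X"
  shows "fg_submodule R X (carrier X)"
proof -
  have "module R X"
    using assms by (auto simp: finitely_presented_def finite_presentation_def)
  then show ?thesis
    using assms unfolding fg_submodule_iff_image[OF R.is_cring \<open>module R X\<close>]
    by (auto simp: finitely_presented_def finite_presentation_def)
qed

lemma annihilator_eq_colon: "annihilator R M = colon R M {\<zero>\<^bsub>M\<^esub>}"
  by (simp add: annihilator_def colon_def)

lemma quotient_by_annihilator:
  assumes M: "M \<in> T"
  shows "fg_submodule R (regular_module R) (annihilator R M)"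
    and "subquotient_in R T (regular_module R) (carrier R) (annihilator R M)"
proof -
  note mM = T_module[OF M] and fgM = fg_carrier[OF T_fp[OF M]]
  obtain S where S: "finite S" "S \<subseteq> carrier M" "carrier M = module.span R M S"
    using fgM unfolding fg_submodule_iff_span[OF mM] by blast
  have "carrier M \<subseteq> L" if "submodule R L M" "S \<subseteq> L" for L
    unfolding S(3) by (rule module.span_is_subset[OF mM that(2,1)])
  then have "fg_submodule R (regular_module R) (annihilator R M) \<and>
    subquotient_in R T (regular_module R) (carrier R) (annihilator R M)"
    unfolding annihilator_eq_colon
    by (intro quotient_by_colon[OF coherent_if_finitely_presented[OF coherent T_fp[OF M]] fgM S(1,2)
          fg_submodule.zero _ subquotient_in_self[OF M]]) auto
  then show "fg_submodule R (regular_module R) (annihilator R M)"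
    and "subquotient_in R T (regular_module R) (carrier R) (annihilator R M)" by auto
qed

text \<open>
  With \<open>I\<close> the annihilator of \<open>M\<close>, the module \<open>N\<close> is filtered by the submodules generated by initial
  segments of a list of generators; each factor is cyclic and killed by \<open>I\<close>, hence a quotient of \<open>R/I\<close>.
\<close>

lemma subquotient_in_if_annihilator_subset:
  assumes M: "M \<in> T" and N: "finitely_presented R N" and ann: "annihilator R M \<subseteq> annihilator R N"
  shows "subquotient_in R T N (carrier N) {\<zero>\<^bsub>N\<^esub>}"
proof -
  note cN = coherent_if_finitely_presented[OF coherent N]
  note mN = coherent_module_is_module[OF cN]
  have "subquotient_in R T N B {\<zero>\<^bsub>N\<^esub>}" if "fg_submodule R N B" for B
    using that
  proof induction
    case zero
    show ?case by (rule subquotient_in_trivial[OF cN fg_submodule.zero])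
  next
    case (adjoin B x)
    interpret B: submodule R B N by (rule fg_submodule_is_submodule[OF mN adjoin.hyps(1)])
    have "subquotient_in R T N (adjoin R N B x) B"
      using ann adjoin.hyps(2)
      by (intro subquotient_in_adjoin[OF cN adjoin.hyps quotient_by_annihilator(2)[OF M]])
        (auto simp: annihilator_def)
    then show ?case
      using subset_adjoin(1)[OF B.submodule_axioms adjoin.hyps(2)] adjoin.IH
      by (intro subquotient_in_extension[OF cN fg_submodule.adjoin[OF adjoin.hyps] adjoin.hyps(1)
            fg_submodule.zero]) auto
  qed
  then show ?thesis using fg_carrier[OF N] by blast
qed

section \<open>Torsion classes are Serre subcategories\<close>

lemma belongs_to_if_same_kernel:
  fixes X :: "('a, 'b) module" and N :: "('a, 'c) module"
  assumes X: "module R X" and N: "module R N"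
    and f: "f \<in> module_hom R X N" "f ` carrier X = carrier N"
    and ker: "\<And>x. x \<in> carrier X \<Longrightarrow> f x = \<zero>\<^bsub>N\<^esub> \<longleftrightarrow> x \<in> K"
    and XK: "subquotient_in R T X (carrier X) K"
  shows "belongs_to R N T"
proof -
  obtain Q g where Q: "Q \<in> T" "g \<in> module_hom R X Q" "g ` carrier X = carrier Q"
    "\<And>a. a \<in> carrier X \<Longrightarrow> g a = \<zero>\<^bsub>Q\<^esub> \<longleftrightarrow> a \<in> K"
    using XK unfolding subquotient_in_def module_hom_carrier_update by blast
  have "module_iso R Q N"
    using ker Q(4)
    by (intro module_iso_if_same_kernel[OF X T_module[OF Q(1)] N Q(2,3) f])
      (auto simp: ker_eq[OF X T_module[OF Q(1)] Q(2)] ker_eq[OF X N f(1)])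
  then show ?thesis using Q(1) by (auto simp: belongs_to_def)
qed

lemma belongs_to_if_annihilator_subset:
  assumes "M \<in> T" and "finitely_presented R N" and "annihilator R M \<subseteq> annihilator R N"
  shows "belongs_to R N T"
proof -
  have N: "module R N"
    by (rule coherent_module_is_module[OF coherent_if_finitely_presented[OF coherent assms(2)]])
  show ?thesis
    by (rule belongs_to_if_same_kernel[OF N N module_hom_id _ _
          subquotient_in_if_annihilator_subset[OF assms]]) auto
qed

lemma quotient_module_is_module:
  assumes "ideal I R"
  shows "module R (quotient_module R I)"
    and "(+>\<^bsub>R\<^esub>) I \<in> module_hom R (regular_module R) (quotient_module R I)"
proof -
  interpret I: ideal I R by (rule assms)
  interpret Q: cring "R Quot I" by (rule I.quotient_is_cring[OF R.is_cring])
  interpret \<pi>: ring_hom_cring R "R Quot I" "(+>\<^bsub>R\<^esub>) I" by (rule I.rcos_ring_hom_cring[OF R.is_cring])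
  show "module R (quotient_module R I)"
  proof (rule moduleI[OF R.is_cring])
    show "abelian_group (quotient_module R I)"
    proof (rule abelian_groupI)
      fix x assume x: "x \<in> carrier (quotient_module R I)"
      then show "\<exists>y \<in> carrier (quotient_module R I). y \<oplus>\<^bsub>quotient_module R I\<^esub> x = \<zero>\<^bsub>quotient_module R I\<^esub>"
        by (intro bexI[of _ "\<ominus>\<^bsub>R Quot I\<^esub> x"]) (auto simp: quotient_module_def Q.l_neg)
    qed (auto simp: quotient_module_def Q.a_ac)
  qed (auto simp: quotient_module_def Q.l_distr Q.r_distr Q.m_assoc)
  show "(+>\<^bsub>R\<^esub>) I \<in> module_hom R (regular_module R) (quotient_module R I)"
    by (intro module_homI) (auto simp: quotient_module_def)
qed

lemma belongs_to_quotient_by_annihilator: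
  assumes M: "M \<in> T"
  shows "belongs_to R (quotient_module R (annihilator R M)) T"
proof -
  let ?I = "annihilator R M"
  have ideal: "ideal ?I R"
    using fg_submodule_is_submodule[OF regular quotient_by_annihilator(1)[OF M]]
    by (simp add: submodule_regular_module_iff[OF R.is_cring])
  interpret I: ideal ?I R by (rule ideal)
  note Q = quotient_module_is_module[OF ideal]
  show ?thesis
  proof (rule belongs_to_if_same_kernel[OF regular Q(1) Q(2)])
    show "(+>\<^bsub>R\<^esub>) ?I ` carrier (regular_module R) = carrier (quotient_module R ?I)"
      by (auto simp: quotient_module_def FactRing_def A_RCOSETS_def' )
    show "?I +>\<^bsub>R\<^esub> r = \<zero>\<^bsub>quotient_module R ?I\<^esub> \<longleftrightarrow> r \<in> ?I" if "r \<in> carrier (regular_module R)" for r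
      using that I.a_rcos_const[of r] I.a_rcos_self[of r] by (auto simp: quotient_module_def FactRing_def)
    show "subquotient_in R T (regular_module R) (carrier (regular_module R)) ?I"
      using quotient_by_annihilator(2)[OF M] by simp
  qed
qed

lemma annihilator_mono:
  assumes M: "module R M" and L: "module R L" and f: "f \<in> module_hom R L M" "inj_on f (carrier L)"
  shows "annihilator R M \<subseteq> annihilator R L"
proof
  interpret mod_hom R L M f by (intro mod_homI assms)
  fix r assume r: "r \<in> annihilator R M"
  then have rR: "r \<in> carrier R" by (simp add: annihilator_def)
  have "r \<odot>\<^bsub>L\<^esub> x = \<zero>\<^bsub>L\<^esub>" if x: "x \<in> carrier L" for x
  proof (rule inj_onD[OF f(2)])
    show "f (r \<odot>\<^bsub>L\<^esub> x) = f \<zero>\<^bsub>L\<^esub>"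
      using r rR x by (simp add: annihilator_def)
  qed (use rR x in auto)
  then show "r \<in> annihilator R L" using rR by (simp add: annihilator_def)
qed

lemma closed_under_subobjects: "closed_under_subobjects R T"
  unfolding closed_under_subobjects_def
proof (intro ballI impI)
  fix M L :: "('a, 'm) module" and f assume M: "M \<in> T" and L: "L \<in> fp_modules R" and f: "f \<in> module_hom R L M" "inj_on f (carrier L)"
  have fpL: "finitely_presented R L" using L by (simp add: fp_modules_def)
  have "module R L" using fpL by (auto simp: finitely_presented_def finite_presentation_def)
  then have "belongs_to R L T"
    using annihilator_mono[OF T_module[OF M] _ f] by (intro belongs_to_if_annihilator_subset[OF M fpL])
  then show "L \<in> T"
    using torsion L unfolding belongs_to_def torsion_class_def subcategory_def by blast
qed

end

theorem theorem2p6: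
  fixes R :: "('a, 'r) ring_scheme" and T :: "('a, 'm) module set"
  assumes "coherent_ring R"
    and "carries_all_fp R TYPE('m)"
    and "torsion_class R T"
  shows "serre_subcategory R T \<and>
    (\<forall>M \<in> T.
      belongs_to R (quotient_module R (annihilator R M)) T \<and>
      (\<forall>N :: ('a, 'n) module.
        finitely_presented R N \<and> annihilator R M \<subseteq> annihilator R N \<longrightarrow> belongs_to R N T))"
proof -
  interpret coherent_torsion_class R T
    using assms by unfold_locales
  have "serre_subcategory R T"
    using assms(3) closed_under_subobjects by (simp add: serre_subcategory_def torsion_class_def)
  then show ?thesis
    using belongs_to_quotient_by_annihilator belongs_to_if_annihilator_subset by blast
qed

end
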